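(* Let $M$ be a manifold of dimension $n$. If $N \leq \left[\frac{n+1}{2}\right]$, then there is a smooth map $F: M \to \mathbf{C}^N$ whose coordinate functions $F_1,\dots,F_N$ are independent, i.e. $dF_1\wedge\cdots\wedge dF_N \neq 0$ at all points of $M$.
   Context: All manifolds are smooth (real, without boundary) and second countable. $[x]$ denotes the greatest integer $\le x$. The $F_j$ are complex-valued smooth functions on $M$, $dF_j$ are the corresponding complex-valued $1$-forms, and the wedge product is taken over $\mathbf{C}$; thus the condition says that $dF_1,\dots,dF_N$ are linearly independent over $\mathbf{C}$ in $\mathrm{Hom}_{\mathbf{R}}(T_pM,\mathbf{C})$ at each $p\in M$. *)

theory Defs
  imports "HOL-Analysis.Analysis"
begin

text \<open>
  Smoothness of maps between open sets of normed spaces. \<open>cont_diff_on k U f\<close> says that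
  \<open>f\<close> is \<open>k\<close> times continuously differentiable on the open set \<open>U\<close>: all iterated directional
  derivatives up to order \<open>k\<close> arise from Frechet derivatives, and those of order \<open>k\<close> are
  continuous. (For a finite-dimensional domain this is the usual class.)
\<close>

primrec cont_diff_on ::
  "nat \<Rightarrow> 'e::real_normed_vector set \<Rightarrow> ('e \<Rightarrow> 'f::real_normed_vector) \<Rightarrow> bool"
where
  "cont_diff_on 0 U f \<longleftrightarrow> continuous_on U f"
| "cont_diff_on (Suc k) U f \<longleftrightarrow>
     (\<exists>f'. (\<forall>x\<in>U. (f has_derivative f' x) (at x)) \<and>
           (\<forall>v. cont_diff_on k U (\<lambda>x. f' x v)))"

definition smooth_on :: "'e::real_normed_vector set \<Rightarrow> ('e \<Rightarrow> 'f::real_normed_vector) \<Rightarrow> bool"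
  where "smooth_on U f \<longleftrightarrow> (\<forall>k. cont_diff_on k U f)"


text \<open>
  A chart is a pair \<open>(U, \<phi>)\<close>; only the values of \<open>\<phi>\<close> on \<open>U\<close> matter. The inverse
  of the coordinate map is \<open>inv_into U \<phi>\<close>, defined on \<open>\<phi> ` U\<close>.
\<close>

type_synonym ('a, 'n) chart = "'a set \<times> ('a \<Rightarrow> real ^ 'n)"

definition is_chart :: "'a topology \<Rightarrow> ('a, 'n::finite) chart \<Rightarrow> bool"
  where "is_chart X = (\<lambda>(U, \<phi>).
    openin X U \<and> open (\<phi> ` U) \<and>
    homeomorphic_map (subtopology X U) (top_of_set (\<phi> ` U)) \<phi>)"

text \<open>Quantifying over ordered pairs of charts makes the transition maps diffeomorphisms.\<close>

definition smooth_atlas :: "'a topology \<Rightarrow> ('a, 'n::finite) chart set \<Rightarrow> bool"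
  where "smooth_atlas X A \<longleftrightarrow>
    (\<forall>c\<in>A. is_chart X c) \<and>
    (\<Union>c\<in>A. fst c) = topspace X \<and>
    (\<forall>(U, \<phi>)\<in>A. \<forall>(V, \<psi>)\<in>A. smooth_on (\<phi> ` (U \<inter> V)) (\<psi> \<circ> inv_into U \<phi>))"

text \<open>
  A smooth manifold of dimension \<open>CARD('n)\<close>, with underlying space \<open>X\<close>. The atlas \<open>A\<close> need
  not be maximal; it stands for the smooth structure that it generates.
\<close>

definition smooth_manifold :: "'a topology \<Rightarrow> ('a, 'n::finite) chart set \<Rightarrow> bool"
  where "smooth_manifold X A \<longleftrightarrow>
    Hausdorff_space X \<and> second_countable X \<and> smooth_atlas X A"

definition smooth_map_from ::
  "('a, 'n::finite) chart set \<Rightarrow> ('a \<Rightarrow> 'f::real_normed_vector) \<Rightarrow> bool"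
  where "smooth_map_from A f \<longleftrightarrow> (\<forall>(U, \<phi>)\<in>A. smooth_on (\<phi> ` U) (f \<circ> inv_into U \<phi>))"


text \<open>
  The differential of \<open>f\<close> at \<open>p\<close>, with the tangent space at \<open>p\<close> identified with
  \<open>real ^ 'n\<close> by means of the chart \<open>(U, \<phi>)\<close> around \<open>p\<close>.
\<close>

definition differential ::
  "('a, 'n::finite) chart \<Rightarrow> ('a \<Rightarrow> 'f::real_normed_vector) \<Rightarrow> 'a \<Rightarrow> real ^ 'n \<Rightarrow> 'f"
  where "differential = (\<lambda>(U, \<phi>) f p. frechet_derivative (f \<circ> inv_into U \<phi>) (at (\<phi> p)))"

text \<open>
  The wedge product over the complex numbers of a family of complex-valued covectors \<open>\<alpha> i\<close>,
  as an alternating form: its value on vectors \<open>v j\<close> is the determinant of the matrix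
  \<open>\<alpha> i (v j)\<close>. Rows and columns have the same index type, so reordering the indices of both
  does not change the determinant; reordering the covectors alone changes the sign only.
\<close>

definition wedge :: "('m::finite \<Rightarrow> 'v \<Rightarrow> complex) \<Rightarrow> ('m \<Rightarrow> 'v) \<Rightarrow> complex"
  where "wedge \<alpha> = (\<lambda>v. det (\<chi> i j. \<alpha> i (v j)))"

text \<open>
  Whether the wedge product vanishes at \<open>p\<close> does not depend on the chart around \<open>p\<close>
  (for smooth \<open>F\<close>), since a change of chart is a linear isomorphism of tangent spaces.
\<close>

definition independent_coordinates_at ::
  "('a, 'n::finite) chart set \<Rightarrow> ('a \<Rightarrow> complex ^ 'm::finite) \<Rightarrow> 'a \<Rightarrow> bool"
  where "independent_coordinates_at A F p \<longleftrightarrow>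
    (\<forall>c\<in>A. p \<in> fst c \<longrightarrow> wedge (\<lambda>i. differential c (\<lambda>x. F x $ i) p) \<noteq> (\<lambda>_. 0))"

end

theory Submission
  imports Defs
begin

text \<open>
  The functions are constructed one at a time. Fix a sequence of charts \<open>(U\<^sub>j, \<phi>\<^sub>j)\<close> and smooth
  \<open>\<rho>\<^sub>j\<close> supported in \<open>U\<^sub>j\<close> such that the sets \<open>\<rho>\<^sub>j > 1\<close> cover \<open>M\<close>, smooth \<open>\<eta>\<^sub>j \<ge> 0\<close> with
  \<open>\<eta>\<^sub>j = 0\<close> exactly where \<open>\<rho>\<^sub>j \<ge> 1\<close>, and \<open>T\<^sub>j = (\<Prod>i<j. \<eta>\<^sub>i)\<close>. The new function is the sum of the terms
  \<open>T\<^sub>j \<rho>\<^sub>j (\<alpha>\<^sub>j \<bullet> \<phi>\<^sub>j + \<beta>\<^sub>j)\<close>. It is locally finite without appeal to paracompactness, because \<open>T\<^sub>k\<close>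
  vanishes where \<open>\<rho>\<^sub>j > 1\<close> for \<open>k > j\<close>. At \<open>p\<close> let \<open>j\<close> be least with \<open>\<rho>\<^sub>j p \<ge> 1\<close>: then
  \<open>T\<^sub>j \<rho>\<^sub>j \<noteq> 0\<close> at \<open>p\<close>, while all later terms vanish to first order there, so only the choice of
  \<open>(\<alpha>\<^sub>j, \<beta>\<^sub>j) \<in> \<complex>\<^sup>n \<times> \<complex>\<close>, made after all earlier choices, decides whether the new differential lies in
  the span of the given ones. The bad parameters form the image of a differentiable map from a manifold
  of real dimension at most \<open>n + 2 N < 2 n + 2\<close>, hence a null set.
\<close>

section \<open>Calculus of \<open>k\<close> times continuously differentiable maps\<close>

lemma cont_diff_on_subset: "cont_diff_on k U f \<Longrightarrow> V \<subseteq> U \<Longrightarrow> cont_diff_on k V f"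
proof (induction k arbitrary: f)
  case 0 then show ?case using continuous_on_subset by auto
next
  case (Suc k)
  from Suc.prems(1) obtain f' where "\<forall>x\<in>U. (f has_derivative f' x) (at x)" "\<forall>v. cont_diff_on k U (\<lambda>x. f' x v)"
    by auto
  with Suc.IH Suc.prems(2) show ?case unfolding cont_diff_on.simps by (intro exI[of _ f']) blast
qed

lemma cont_diff_on_cong:
  assumes "open U" "\<And>x. x \<in> U \<Longrightarrow> f x = g x" "cont_diff_on k U f"
  shows "cont_diff_on k U g"
proof (cases k)
  case 0 then show ?thesis using assms by (simp cong: continuous_on_cong_simp)
next
  case (Suc j)
  then obtain f' where f': "\<forall>x\<in>U. (f has_derivative f' x) (at x)" "\<forall>v. cont_diff_on j U (\<lambda>x. f' x v)"
    using assms(3) by auto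
  have "(g has_derivative f' x) (at x)" if "x \<in> U" for x
    using has_derivative_transform_within_open[OF _ assms(1) that] f'(1) assms(2) that by blast
  then show ?thesis using f'(2) Suc by auto
qed

text \<open>Derivatives at a point are unique, so the existential witness may be replaced by
  \<open>frechet_derivative f (at x)\<close>, which does not depend on the set. Witnesses over
  different neighbourhoods therefore agree, as gluing in \<open>cont_diff_on_local\<close>
  requires.\<close>

lemma cont_diff_on_Suc_iff:
  assumes "open U"
  shows "cont_diff_on (Suc k) U f \<longleftrightarrow>
    (\<forall>x\<in>U. f differentiable (at x)) \<and> (\<forall>v. cont_diff_on k U (\<lambda>x. frechet_derivative f (at x) v))"
proof
  assume "cont_diff_on (Suc k) U f"
  then obtain f' where f': "\<forall>x\<in>U. (f has_derivative f' x) (at x)" "\<forall>v. cont_diff_on k U (\<lambda>x. f' x v)"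
    by auto
  have "f' x = frechet_derivative f (at x)" if "x \<in> U" for x
    using f'(1) that frechet_derivative_at by blast
  then have "cont_diff_on k U (\<lambda>x. frechet_derivative f (at x) v)" for v
    using cont_diff_on_cong[OF assms _ f'(2)[rule_format, of v]] by simp
  with f'(1) show "(\<forall>x\<in>U. f differentiable (at x)) \<and>
      (\<forall>v. cont_diff_on k U (\<lambda>x. frechet_derivative f (at x) v))"
    by (auto simp: differentiable_def)
qed (auto simp: frechet_derivative_works)

lemma cont_diff_on_local:
  assumes "open U" "\<And>x. x \<in> U \<Longrightarrow> \<exists>W. open W \<and> x \<in> W \<and> cont_diff_on k (W \<inter> U) f"
  shows "cont_diff_on k U f"
  using assms(2)
proof (induction k arbitrary: f)
  case 0
  show ?case unfolding cont_diff_on.simps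
  proof (rule continuous_at_imp_continuous_on, rule ballI)
    fix x assume "x \<in> U"
    from 0[OF this] obtain W where W: "open W" "x \<in> W" "continuous_on (W \<inter> U) f"
      unfolding cont_diff_on.simps by blast
    show "isCont f x" using W assms(1) \<open>x \<in> U\<close>
      continuous_on_eq_continuous_at[of "W \<inter> U" f] by blast
  qed
next
  case (Suc k)
  have *: "\<exists>W. open W \<and> x \<in> W \<and> f differentiable (at x) \<and>
      (\<forall>v. cont_diff_on k (W \<inter> U) (\<lambda>x. frechet_derivative f (at x) v))" if x: "x \<in> U" for x
  proof -
    obtain W where W: "open W" "x \<in> W" "cont_diff_on (Suc k) (W \<inter> U) f" using Suc.prems[OF x] by blast
    then show ?thesis using x cont_diff_on_Suc_iff[of "W \<inter> U" k f] assms(1)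
      by (intro exI[of _ W]) (auto simp del: cont_diff_on.simps)
  qed
  show ?case unfolding cont_diff_on_Suc_iff[OF assms(1)]
  proof (intro conjI ballI allI)
    fix x assume "x \<in> U" then show "f differentiable (at x)" using * by blast
  next
    fix v show "cont_diff_on k U (\<lambda>x. frechet_derivative f (at x) v)"
      by (rule Suc.IH) (use * in meson)
  qed
qed

lemma cont_diff_on_imp_continuous_on: "cont_diff_on k U f \<Longrightarrow> continuous_on U f"
proof (cases k)
  case (Suc j)
  assume "cont_diff_on k U f"
  then obtain f' where "\<forall>x\<in>U. (f has_derivative f' x) (at x)" using Suc by auto
  then show ?thesis
    by (meson continuous_at_imp_continuous_on has_derivative_continuous)
qed simp

lemma cont_diff_on_SucD: "cont_diff_on (Suc k) U f \<Longrightarrow> cont_diff_on k U f"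
proof (induction k arbitrary: f)
  case 0 then show ?case using cont_diff_on_imp_continuous_on[of "Suc 0" U f] by simp
next
  case (Suc k) then show ?case by (metis cont_diff_on.simps(2))
qed

lemma cont_diff_on_const: "cont_diff_on k U (\<lambda>x. c)"
proof (induction k arbitrary: c)
  case (Suc k) then show ?case by (auto intro!: exI[of _ "\<lambda>x v. 0"])
qed simp

lemma cont_diff_on_add:
  "cont_diff_on k U f \<Longrightarrow> cont_diff_on k U g \<Longrightarrow> cont_diff_on k U (\<lambda>x. f x + g x)"
proof (induction k arbitrary: f g)
  case 0 then show ?case by (auto intro: continuous_intros)
next
  case (Suc k)
  obtain f' g' where "\<forall>x\<in>U. (f has_derivative f' x) (at x)" "\<forall>v. cont_diff_on k U (\<lambda>x. f' x v)"
    "\<forall>x\<in>U. (g has_derivative g' x) (at x)" "\<forall>v. cont_diff_on k U (\<lambda>x. g' x v)"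
    using Suc.prems by auto
  then show ?case using Suc.IH unfolding cont_diff_on.simps
    by (intro exI[of _ "\<lambda>x v. f' x v + g' x v"]) (auto intro: has_derivative_add)
qed

lemma (in bounded_bilinear) cont_diff_on:
  "cont_diff_on k U f \<Longrightarrow> cont_diff_on k U g \<Longrightarrow> cont_diff_on k U (\<lambda>x. prod (f x) (g x))"
proof (induction k arbitrary: f g)
  case 0 then show ?case by (simp add: continuous_on)
next
  case (Suc k)
  obtain f' g' where fg': "\<forall>x\<in>U. (f has_derivative f' x) (at x)" "\<forall>v. cont_diff_on k U (\<lambda>x. f' x v)"
    "\<forall>x\<in>U. (g has_derivative g' x) (at x)" "\<forall>v. cont_diff_on k U (\<lambda>x. g' x v)"
    using Suc.prems by auto
  have "cont_diff_on k U f" "cont_diff_on k U g" using Suc.prems cont_diff_on_SucD by blast+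
  then have "cont_diff_on k U (\<lambda>x. prod (f x) (g' x v) + prod (f' x v) (g x))" for v
    using fg' by (intro cont_diff_on_add Suc.IH) auto
  moreover have "((\<lambda>x. prod (f x) (g x)) has_derivative (\<lambda>v. prod (f x) (g' x v) + prod (f' x v) (g x))) (at x)"
    if "x \<in> U" for x using fg' that by (intro FDERIV) auto
  ultimately show ?case unfolding cont_diff_on.simps
    by (intro exI[of _ "\<lambda>x v. prod (f x) (g' x v) + prod (f' x v) (g x)"]) auto
qed

lemma (in bounded_linear) cont_diff_on:
  "cont_diff_on k U g \<Longrightarrow> cont_diff_on k U (\<lambda>x. f (g x))"
proof (induction k arbitrary: g)
  case 0 then show ?case by (auto intro: continuous_on)
next
  case (Suc k)
  obtain g' where "\<forall>x\<in>U. (g has_derivative g' x) (at x)" "\<forall>v. cont_diff_on k U (\<lambda>x. g' x v)"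
    using Suc.prems by auto
  then show ?case using Suc.IH unfolding cont_diff_on.simps
    by (intro exI[of _ "\<lambda>x v. f (g' x v)"]) (auto intro: has_derivative)
qed

lemma cont_diff_on_ident: "cont_diff_on k U (\<lambda>x. x)"
proof (cases k)
  case (Suc j)
  then show ?thesis by (auto intro!: exI[of _ "\<lambda>x v. v"] cont_diff_on_const)
qed auto

lemma cont_diff_on_sum:
  "finite I \<Longrightarrow> (\<And>i. i \<in> I \<Longrightarrow> cont_diff_on k U (f i)) \<Longrightarrow> cont_diff_on k U (\<lambda>x. \<Sum>i\<in>I. f i x)"
  by (induction I rule: finite_induct) (auto intro: cont_diff_on_const cont_diff_on_add)

text \<open>The chain rule yields \<open>g' (f x) (f' x v)\<close>, whose direction varies with
  \<open>x\<close>, while \<open>cont_diff_on\<close> controls fixed directions only. Expanding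
  \<open>f' x v\<close> in the basis of the Euclidean intermediate space leaves fixed directions
  \<open>b\<close> with scalar coefficients, to which the induction hypothesis and the product rule
  apply.\<close>

lemma cont_diff_on_compose:
  fixes g :: "'d::euclidean_space \<Rightarrow> 'f::real_normed_vector"
  assumes "cont_diff_on k V g" "cont_diff_on k U f" "f ` U \<subseteq> V"
  shows "cont_diff_on k U (\<lambda>x. g (f x))"
  using assms
proof (induction k arbitrary: g)
  case 0 then show ?case by (auto intro: continuous_on_compose2)
next
  case (Suc k)
  obtain f' g' where f': "\<forall>x\<in>U. (f has_derivative f' x) (at x)" "\<forall>v. cont_diff_on k U (\<lambda>x. f' x v)"
    and g': "\<forall>x\<in>V. (g has_derivative g' x) (at x)" "\<forall>v. cont_diff_on k V (\<lambda>x. g' x v)"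
    using Suc.prems by auto
  have f: "cont_diff_on k U f" using Suc.prems cont_diff_on_SucD by blast
  have "((\<lambda>x. g (f x)) has_derivative (\<lambda>v. \<Sum>b\<in>Basis. (f' x v \<bullet> b) *\<^sub>R g' (f x) b)) (at x)"
    if "x \<in> U" for x
  proof -
    have g: "(g has_derivative g' (f x)) (at (f x))" using g' that Suc.prems by blast
    have eq: "(\<lambda>v. g' (f x) (f' x v)) = (\<lambda>v. \<Sum>b\<in>Basis. (f' x v \<bullet> b) *\<^sub>R g' (f x) b)"
    proof
      fix v
      show "g' (f x) (f' x v) = (\<Sum>b\<in>Basis. (f' x v \<bullet> b) *\<^sub>R g' (f x) b)"
        using linear_sum[OF has_derivative_linear[OF g], of "\<lambda>b. (f' x v \<bullet> b) *\<^sub>R b" Basis]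
        by (simp add: euclidean_representation linear_cmul[OF has_derivative_linear[OF g]])
    qed
    have "(f has_derivative f' x) (at x)" using f' that by blast
    from has_derivative_compose[of f "f' x" x UNIV g, OF this g] show ?thesis
      unfolding eq .
  qed
  moreover have "cont_diff_on k U (\<lambda>x. \<Sum>b\<in>Basis. (f' x v \<bullet> b) *\<^sub>R g' (f x) b)" for v
    by (intro cont_diff_on_sum bounded_bilinear.cont_diff_on[OF bounded_bilinear_scaleR]
        bounded_linear.cont_diff_on[OF bounded_linear_inner_left] Suc.IH)
      (use f' g' f Suc.prems in auto)
  ultimately show ?case unfolding cont_diff_on.simps
    by (intro exI[of _ "\<lambda>x v. \<Sum>b\<in>Basis. (f' x v \<bullet> b) *\<^sub>R g' (f x) b"]) auto
qed

section \<open>A flat cutoff function\<close>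

definition exp_cutoff :: "nat \<Rightarrow> real \<Rightarrow> real"
  where "exp_cutoff n t = (if t \<le> 0 then 0 else inverse t ^ n * exp (- inverse t))"

text \<open>From the right, s = 1/t turns the claim into s^n / exp s tending to 0 as s tends to
  infinity; from the left the function is constantly 0.\<close>

lemma exp_cutoff_tendsto_0: "(exp_cutoff n \<longlongrightarrow> 0) (at 0)"
proof -
  have "((\<lambda>t. inverse t ^ n / exp (inverse t)) \<longlongrightarrow> (0::real)) (at_right 0)"
    by (rule filterlim_compose[OF tendsto_power_div_exp_0 filterlim_inverse_at_top_right])
  moreover have "\<forall>\<^sub>F t in at_right 0. inverse t ^ n / exp (inverse t) = exp_cutoff n t"
    unfolding eventually_at_right_field
    by (intro exI[of _ 1]) (auto simp: exp_cutoff_def exp_minus field_simps)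
  ultimately have r: "(exp_cutoff n \<longlongrightarrow> 0) (at_right 0)" by (rule Lim_transform_eventually)
  have "\<forall>\<^sub>F t in at_left 0. 0 = exp_cutoff n t"
    unfolding eventually_at_left_field by (intro exI[of _ "-1"]) (auto simp: exp_cutoff_def)
  then have "(exp_cutoff n \<longlongrightarrow> 0) (at_left 0)" by (rule Lim_transform_eventually[OF tendsto_const])
  with r show ?thesis by (simp add: filterlim_split_at)
qed

text \<open>
  The factor \<open>inverse t ^ n\<close> makes the family closed under differentiation, so that all its members
  are shown to be smooth by one induction.
\<close>

lemma exp_cutoff_DERIV:
  "(exp_cutoff n has_real_derivative exp_cutoff (n + 2) t - n * exp_cutoff (n + 1) t) (at t)"
proof -
  consider "t < 0" | "t > 0" | "t = 0" by linarith
  then show ?thesis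
  proof cases
    case 1
    have "((\<lambda>t. 0) has_real_derivative exp_cutoff (n + 2) t - n * exp_cutoff (n + 1) t) (at t)"
      using 1 by (simp add: exp_cutoff_def)
    then show ?thesis
      by (rule has_field_derivative_transform_within_open[where S = "{..<0}"]) (use 1 in \<open>auto simp: exp_cutoff_def\<close>)
  next
    case 2
    have "((\<lambda>t. inverse t ^ n) has_real_derivative - n * inverse t ^ (n + 1)) (at t)"
    proof (cases n)
      case (Suc m)
      have "((\<lambda>t. inverse t ^ Suc m) has_real_derivative
          real (Suc m) * (- (inverse t ^ Suc (Suc 0)) * inverse t ^ m)) (at t)"
        using DERIV_power[OF DERIV_inverse[of t], where n = "Suc m"] 2 by simp
      moreover have "real (Suc m) * (- (inverse t ^ Suc (Suc 0)) * inverse t ^ m) = - n * inverse t ^ (n + 1)"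
        by (simp add: Suc algebra_simps)
      ultimately show ?thesis using Suc by simp
    qed simp
    moreover have "((\<lambda>t. exp (- inverse t)) has_real_derivative exp (- inverse t) * inverse t ^ 2) (at t)"
      using 2 by (auto intro!: derivative_eq_intros simp: power2_eq_square)
    ultimately have "((\<lambda>t. inverse t ^ n * exp (- inverse t)) has_real_derivative
        - n * inverse t ^ (n + 1) * exp (- inverse t) + exp (- inverse t) * inverse t ^ 2 * inverse t ^ n) (at t)"
      by (rule DERIV_mult)
    moreover have "- n * inverse t ^ (n + 1) * exp (- inverse t) + exp (- inverse t) * inverse t ^ 2 * inverse t ^ n
        = exp_cutoff (n + 2) t - n * exp_cutoff (n + 1) t"
      using 2 by (simp add: exp_cutoff_def power2_eq_square)
    ultimately have "((\<lambda>t. inverse t ^ n * exp (- inverse t)) has_real_derivative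
        exp_cutoff (n + 2) t - n * exp_cutoff (n + 1) t) (at t)" by simp
    then show ?thesis
      by (rule has_field_derivative_transform_within_open[where S = "{0<..}"]) (use 2 in \<open>auto simp: exp_cutoff_def\<close>)
  next
    case 3
    \<comment> \<open>At 0 the difference quotient is itself the next member of the family, hence
      tends to 0; both terms of the claimed derivative vanish there.\<close>
    have "(exp_cutoff n h - exp_cutoff n 0) / h = exp_cutoff (n + 1) h" for h
      by (simp add: exp_cutoff_def divide_inverse)
    moreover have "exp_cutoff k 0 = 0" for k by (simp add: exp_cutoff_def)
    ultimately show ?thesis using 3 exp_cutoff_tendsto_0[of "n + 1"]
      by (simp add: has_field_derivative_iff)
  qed
qed

lemma cont_diff_on_exp_cutoff: "cont_diff_on k U (exp_cutoff n)"
proof (induction k arbitrary: n)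
  case 0
  have "isCont (exp_cutoff n) x" for x by (rule DERIV_isCont[OF exp_cutoff_DERIV])
  then show ?case by (simp add: continuous_at_imp_continuous_on)
next
  case (Suc k)
  have *: "cont_diff_on k U (\<lambda>x. exp_cutoff (n + 2) x * v + exp_cutoff (n + 1) x * (- real n * v))" for v
    by (intro cont_diff_on_add bounded_linear.cont_diff_on[OF bounded_linear_mult_left] Suc.IH)
  have "(exp_cutoff n has_derivative
      (\<lambda>v. exp_cutoff (n + 2) x * v + exp_cutoff (n + 1) x * (- real n * v))) (at x)" for x
    by (rule has_derivative_eq_rhs[OF exp_cutoff_DERIV[of n x, unfolded has_field_derivative_def]])
      (simp add: fun_eq_iff algebra_simps)
  with * show ?case unfolding cont_diff_on.simps
    by (intro exI[of _ "\<lambda>x v. exp_cutoff (n + 2) x * v + exp_cutoff (n + 1) x * (- real n * v)"]) auto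
qed

section \<open>Avoiding a span by an affine perturbation\<close>

lemma differentiable_vec_nth_within:
  fixes f :: "'e::real_normed_vector \<Rightarrow> 'f::euclidean_space ^ 'n"
  assumes "\<And>i. (\<lambda>x. f x $ i) differentiable (at x within S)"
  shows "f differentiable (at x within S)"
proof -
  have "\<exists>D. ((\<lambda>x. f x $ i) has_derivative D) (at x within S)" for i
    using assms unfolding differentiable_def by blast
  then obtain D where D: "((\<lambda>x. f x $ i) has_derivative D i) (at x within S)" for i by metis
  have "(f has_derivative (\<lambda>v. \<chi> i. D i v)) (at x within S)"
  proof (subst has_derivative_componentwise_within, rule ballI)
    fix b :: "'f ^ 'n" assume "b \<in> Basis"
    then obtain i u where b: "b = axis i u" by (auto simp: Basis_vec_def)
    show "((\<lambda>x. f x \<bullet> b) has_derivative (\<lambda>v. (\<chi> i. D i v) \<bullet> b)) (at x within S)"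
      using has_derivative_inner_left[OF D[of i], of u] by (simp add: b inner_axis)
  qed
  then show ?thesis unfolding differentiable_def by blast
qed

lemma frechet_derivative_differentiable:
  assumes "open U" "cont_diff_on (Suc (Suc 0)) U f" "x \<in> U"
  shows "(\<lambda>x. frechet_derivative f (at x) v) differentiable (at x)"
  using assms cont_diff_on_Suc_iff by blast

lemma cont_diff_on_Suc_has_derivative:
  assumes "open U" "cont_diff_on (Suc k) U f" "x \<in> U"
  shows "(f has_derivative frechet_derivative f (at x)) (at x)"
  using assms cont_diff_on_Suc_iff frechet_derivative_works by blast

text \<open>
  If \<open>h + g (\<alpha> \<bullet> x + \<beta>)\<close> has differential \<open>\<Sum>k\<in>S. c\<^sub>k dF\<^sub>k\<close> at \<open>x\<close>, then \<open>\<alpha>\<close> and \<open>\<beta>\<close> are determined by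
  \<open>x\<close>, \<open>c\<close> and \<open>w = \<alpha> \<bullet> x + \<beta>\<close>. In \<open>\<Phi>\<close> the component \<open>c $ s\<close>, which is free since \<open>s \<notin> S\<close>, carries \<open>w\<close>;
  the source then has real dimension \<open>n + 2 * CARD('m)\<close>, the target \<open>2 * n + 2\<close>.
\<close>

lemma affine_perturbation_avoids_span:
  fixes U :: "(real ^ 'n) set" and F :: "'m::finite \<Rightarrow> real ^ 'n \<Rightarrow> complex"
    and h :: "real ^ 'n \<Rightarrow> complex" and g :: "real ^ 'n \<Rightarrow> real"
  assumes U: "open U" and h: "cont_diff_on 2 U h" and g: "cont_diff_on 2 U g"
    and F: "\<And>k. k \<in> S \<Longrightarrow> cont_diff_on 2 U (F k)"
    and s: "s \<notin> S" and dim: "2 * CARD('m) \<le> CARD('n) + 1"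
  shows "\<exists>\<alpha> \<beta>. \<forall>x\<in>U. g x \<noteq> 0 \<longrightarrow> (\<forall>a. \<exists>v.
    frechet_derivative (\<lambda>x. h x + g x *\<^sub>R ((\<Sum>l\<in>UNIV. x $ l *\<^sub>R \<alpha> l) + \<beta>)) (at x) v \<noteq>
    (\<Sum>k\<in>S. a k * frechet_derivative (F k) (at x) v))"
proof -
  define h' where "h' = (\<lambda>x. frechet_derivative h (at x))"
  define g' where "g' = (\<lambda>x. frechet_derivative g (at x))"
  define F' where "F' = (\<lambda>k x. frechet_derivative (F k) (at x))"
  define e :: "'n \<Rightarrow> real ^ 'n" where "e = (\<lambda>l. axis l 1)"
  define P where "P = (\<lambda>z::(real ^ 'n) \<times> (complex ^ 'm). \<chi> l.
    inverse (g (fst z)) *\<^sub>R ((\<Sum>k\<in>S. snd z $ k * F' k (fst z) (e l)) - h' (fst z) (e l)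
      - g' (fst z) (e l) *\<^sub>R snd z $ s))"
  define \<Phi> where "\<Phi> = (\<lambda>z. (P z, snd z $ s - (\<Sum>l\<in>UNIV. fst z $ l *\<^sub>R P z $ l)))"
  define Z where "Z = {z::(real ^ 'n) \<times> (complex ^ 'm). fst z \<in> U \<and> g (fst z) \<noteq> 0}"
  have dsnd: "(\<lambda>z. snd z $ k) differentiable (at z within Z)" for k z
    by (intro bounded_linear_imp_differentiable bounded_linear_compose[OF bounded_linear_vec_nth bounded_linear_snd])
  have dfst: "(\<lambda>z. fst z $ k) differentiable (at z within Z)" for k z
    by (intro bounded_linear_imp_differentiable bounded_linear_compose[OF bounded_linear_vec_nth bounded_linear_fst])
  have comp: "(\<lambda>z. q (fst z)) differentiable (at z within Z)"
    if "q differentiable (at (fst z))" for q :: "real ^ 'n \<Rightarrow> 'z::real_normed_vector" and z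
  proof -
    have "fst differentiable (at z within Z)"
      by (intro bounded_linear_imp_differentiable bounded_linear_fst)
    then show ?thesis using differentiable_compose[of q fst z Z] that by blast
  qed
  note C2 = h[unfolded numeral_2_eq_2] g[unfolded numeral_2_eq_2] F[unfolded numeral_2_eq_2]
  note defs = h'_def g'_def F'_def
  have dP: "(\<lambda>z. P z $ l) differentiable (at z within Z)" if "z \<in> Z" for z l
  proof -
    have z: "fst z \<in> U" "g (fst z) \<noteq> 0" using that by (auto simp: Z_def)
    have "(\<lambda>x. h' x (e l)) differentiable (at (fst z))" "(\<lambda>x. g' x (e l)) differentiable (at (fst z))"
      "\<And>k. k \<in> S \<Longrightarrow> (\<lambda>x. F' k x (e l)) differentiable (at (fst z))"
      unfolding defs using frechet_derivative_differentiable[OF U _ z(1)] C2 by blast+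
    moreover have "g differentiable (at (fst z))"
      using cont_diff_on_Suc_has_derivative[OF U C2(2) z(1)] by (auto simp: differentiable_def)
    ultimately have d: "(\<lambda>z. h' (fst z) (e l)) differentiable (at z within Z)"
      "(\<lambda>z. g' (fst z) (e l)) differentiable (at z within Z)"
      "\<And>k. k \<in> S \<Longrightarrow> (\<lambda>z. F' k (fst z) (e l)) differentiable (at z within Z)"
      "(\<lambda>z. g (fst z)) differentiable (at z within Z)"
      using comp by blast+
    show ?thesis unfolding P_def vec_lambda_beta
      by (intro differentiable_scaleR differentiable_diff differentiable_mult
        differentiable_inverse differentiable_sum ballI dsnd d finite z(2))
  qed
  have "\<Phi> differentiable_on Z"
    unfolding differentiable_on_def \<Phi>_def
    by (intro ballI differentiable_Pair differentiable_diff differentiable_sum differentiable_scaleR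
        differentiable_vec_nth_within ballI finite dP dsnd dfst)
  \<comment> \<open>By \<open>dim\<close>, n + 2 CARD('m) \<le> 2 n + 1, so the source has smaller
    real dimension than the target.\<close>
  then have "negligible (\<Phi> ` Z)"
    by (rule negligible_differentiable_image_lowdim[rotated]) (use dim in simp)
  then have "\<Phi> ` Z \<noteq> UNIV" using non_negligible_UNIV by metis
  then obtain \<alpha> \<beta> where nin: "(\<alpha>, \<beta>) \<notin> \<Phi> ` Z" by (metis UNIV_eq_I surj_pair)
  show ?thesis
  proof (intro exI[of _ "($) \<alpha>"] exI[of _ \<beta>] ballI impI allI, rule ccontr)
    fix x and a :: "'m \<Rightarrow> complex" assume x: "x \<in> U" "g x \<noteq> 0"
    define w where "w = (\<Sum>l\<in>UNIV. x $ l *\<^sub>R \<alpha> $ l) + \<beta>"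
    assume "\<nexists>v. frechet_derivative (\<lambda>x. h x + g x *\<^sub>R ((\<Sum>l\<in>UNIV. x $ l *\<^sub>R \<alpha> $ l) + \<beta>)) (at x) v \<noteq>
      (\<Sum>k\<in>S. a k * frechet_derivative (F k) (at x) v)"
    then have eq: "frechet_derivative (\<lambda>x. h x + g x *\<^sub>R ((\<Sum>l\<in>UNIV. x $ l *\<^sub>R \<alpha> $ l) + \<beta>)) (at x) v =
      (\<Sum>k\<in>S. a k * F' k x v)" for v by (auto simp: F'_def)
    have "(h has_derivative h' x) (at x)" "(g has_derivative g' x) (at x)"
      unfolding defs using cont_diff_on_Suc_has_derivative[OF U _ x(1)] C2 by blast+
    moreover have "((\<lambda>x. (\<Sum>l\<in>UNIV. x $ l *\<^sub>R \<alpha> $ l) + \<beta>) has_derivative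
      (\<lambda>v. \<Sum>l\<in>UNIV. v $ l *\<^sub>R \<alpha> $ l)) (at x)"
      by (intro has_derivative_add_const bounded_linear_imp_has_derivative bounded_linear_sum
        bounded_linear_compose[OF bounded_linear_scaleR_left bounded_linear_vec_nth])
    ultimately have "((\<lambda>x. h x + g x *\<^sub>R ((\<Sum>l\<in>UNIV. x $ l *\<^sub>R \<alpha> $ l) + \<beta>)) has_derivative
      (\<lambda>v. h' x v + (g x *\<^sub>R (\<Sum>l\<in>UNIV. v $ l *\<^sub>R \<alpha> $ l) + g' x v *\<^sub>R w))) (at x)"
      unfolding w_def by (intro has_derivative_add has_derivative_scaleR)
    then have D: "frechet_derivative (\<lambda>x. h x + g x *\<^sub>R ((\<Sum>l\<in>UNIV. x $ l *\<^sub>R \<alpha> $ l) + \<beta>)) (at x) =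
      (\<lambda>v. h' x v + (g x *\<^sub>R (\<Sum>l\<in>UNIV. v $ l *\<^sub>R \<alpha> $ l) + g' x v *\<^sub>R w))"
      by (rule frechet_derivative_at[symmetric])
    have eq2: "(\<Sum>k\<in>S. a k * F' k x v) = h' x v + (g x *\<^sub>R (\<Sum>l\<in>UNIV. v $ l *\<^sub>R \<alpha> $ l) + g' x v *\<^sub>R w)" for v
      using eq[of v] by (simp only: D)
    \<comment> \<open>Evaluating the relation on the basis vector \<open>e i\<close> isolates
      \<open>\<alpha> $ i\<close>; dividing by \<open>g x\<close> gives the formula used for
      \<open>P\<close>.\<close>
    have "(\<Sum>l\<in>UNIV. e i $ l *\<^sub>R \<alpha> $ l) = \<alpha> $ i" for i
      by (subst sum.remove[of _ i]) (auto simp: e_def axis_def)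
    with eq2[of "e i" for i] have eq3: "g x *\<^sub>R \<alpha> $ i = (\<Sum>k\<in>S. a k * F' k x (e i)) - h' x (e i) - g' x (e i) *\<^sub>R w" for i
      by (simp add: algebra_simps)
    define c where "c = (\<chi> k. if k = s then w else a k)"
    have "(\<Sum>k\<in>S. c $ k * F' k x (e l)) = (\<Sum>k\<in>S. a k * F' k x (e l))" for l
      using s by (intro sum.cong) (auto simp: c_def)
    then have "P (x, c) = \<alpha>"
      by (simp add: P_def vec_eq_iff c_def flip: eq3) (use x in simp)
    then have "\<Phi> (x, c) = (\<alpha>, \<beta>)" by (simp add: \<Phi>_def c_def w_def)
    moreover have "(x, c) \<in> Z" using x by (simp add: Z_def)
    ultimately show False using nin by (metis imageI)
  qed
qed

text \<open>Row rank equals column rank. A maximal independent set \<open>B\<close> of columns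
  \<open>col v\<close> has at most CARD('m) elements, so a single choice of vectors \<open>w\<close>
  realises all of \<open>B\<close> as columns of a square matrix. If its determinant is 0, its rows
  satisfy a nontrivial relation \<open>x\<close>; this relation annihilates \<open>B\<close>, hence
  every column in its span, and so is a relation between the covectors themselves.\<close>

lemma wedge_nonzero:
  fixes \<alpha> :: "'m::finite \<Rightarrow> 'v \<Rightarrow> complex"
  assumes "\<And>a. (\<And>v. (\<Sum>k\<in>UNIV. a k * \<alpha> k v) = 0) \<Longrightarrow> \<forall>k. a k = 0"
  shows "wedge \<alpha> \<noteq> (\<lambda>_. 0)"
proof
  assume "wedge \<alpha> = (\<lambda>_. 0)"
  then have det0: "det (\<chi> i j. \<alpha> i (v j)) = 0" for v by (auto simp: wedge_def fun_eq_iff)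
  define col :: "'v \<Rightarrow> complex ^ 'm" where "col = (\<lambda>v. \<chi> i. \<alpha> i v)"
  obtain B where B: "B \<subseteq> range col" "vec.independent B" "range col \<subseteq> vec.span B"
    using vec.maximal_independent_subset by metis
  have finB: "finite B" using vec.finiteI_independent B(2) by blast
  have "card B \<le> CARD('m)"
    using vec.independent_span_bound[OF finite_cart_basis B(2)] by (simp add: card_cart_basis)
  then obtain u0 :: "complex ^ 'm \<Rightarrow> 'm" where u0: "inj_on u0 B"
    using finB by (metis card_le_inj finite_class.finite_UNIV)
  define w where "w = (\<lambda>i. if i \<in> u0 ` B then (SOME v. col v = inv_into B u0 i) else undefined)"
  have w: "\<exists>i. col (w i) = b" if "b \<in> B" for b
  proof -
    have "\<exists>v. col v = b" using B(1) that by auto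
    then have "col (SOME v. col v = b) = b" by (rule someI_ex)
    then show ?thesis using that u0 by (intro exI[of _ "u0 b"]) (auto simp: w_def)
  qed
  define M where "M = (\<chi> i j. \<alpha> i (w j))"
  have "det (transpose M) = 0" using det0 by (simp add: M_def det_transpose)
  then obtain x where x: "transpose M *v x = 0" "x \<noteq> 0"
    using matrix_left_invertible_ker[of "transpose M"] invertible_left_inverse invertible_det_nz by metis
  define N where "N = {y. (\<Sum>k\<in>UNIV. x $ k * y $ k) = 0}"
  have "vec.subspace N"
    unfolding vec.subspace_def N_def
    by (auto simp: algebra_simps sum.distrib simp flip: sum_distrib_left)
  moreover have "B \<subseteq> N"
  proof
    fix b assume "b \<in> B"
    then obtain i where i: "col (w i) = b" using w by blast
    have "(transpose M *v x) $ i = 0" using x by simp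
    then show "b \<in> N" by (simp add: N_def M_def matrix_vector_mult_def transpose_def col_def mult.commute flip: i)
  qed
  ultimately have "range col \<subseteq> N" using B(3) vec.span_minimal by blast
  then have "(\<Sum>k\<in>UNIV. x $ k * \<alpha> k v) = 0" for v by (force simp: N_def col_def image_subset_iff)
  then have "\<forall>k. x $ k = 0" by (rule assms)
  with x(2) show False by (simp add: vec_eq_iff)
qed

section \<open>Smooth maps and bump functions on a manifold\<close>

lemma smooth_on_imp_cont_diff_on: "smooth_on U f \<Longrightarrow> cont_diff_on k U f"
  by (simp add: smooth_on_def)

lemma smooth_map_fromD:
  "smooth_map_from A f \<Longrightarrow> (U, \<phi>) \<in> A \<Longrightarrow> cont_diff_on k (\<phi> ` U) (f \<circ> inv_into U \<phi>)"
  unfolding smooth_map_from_def smooth_on_def by blast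

lemma smooth_map_fromI:
  "(\<And>U \<phi> k. (U, \<phi>) \<in> A \<Longrightarrow> cont_diff_on k (\<phi> ` U) (f \<circ> inv_into U \<phi>)) \<Longrightarrow> smooth_map_from A f"
  unfolding smooth_map_from_def smooth_on_def by blast

lemma frechet_derivative_cong_open:
  assumes "open W" "x \<in> W" "\<And>y. y \<in> W \<Longrightarrow> f y = g y"
  shows "frechet_derivative f (at x) = frechet_derivative g (at x)"
proof -
  have "(f has_derivative D) (at x) = (g has_derivative D) (at x)" for D
    using has_derivative_transform_within_open[OF _ assms(1,2), of f D UNIV g]
      has_derivative_transform_within_open[OF _ assms(1,2), of g D UNIV f] assms(3) by auto
  then show ?thesis by (simp add: frechet_derivative_def)
qed

lemma smooth_map_from_const: "smooth_map_from A (\<lambda>p. c)"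
  by (rule smooth_map_fromI) (simp add: comp_def cont_diff_on_const)

lemma smooth_map_from_add:
  assumes f: "smooth_map_from A f" and g: "smooth_map_from A g"
  shows "smooth_map_from A (\<lambda>p. f p + g p)"
proof (rule smooth_map_fromI)
  fix U \<phi> k assume "(U, \<phi>) \<in> A"
  note D = smooth_map_fromD[OF _ this]
  show "cont_diff_on k (\<phi> ` U) ((\<lambda>p. f p + g p) \<circ> inv_into U \<phi>)"
    using cont_diff_on_add[OF D[OF f] D[OF g]] by (simp add: comp_def)
qed

lemma smooth_map_from_scaleR:
  assumes f: "smooth_map_from A f" and g: "smooth_map_from A g"
  shows "smooth_map_from A (\<lambda>p. f p *\<^sub>R g p)"
proof (rule smooth_map_fromI)
  fix U \<phi> k assume "(U, \<phi>) \<in> A"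
  note D = smooth_map_fromD[OF _ this]
  show "cont_diff_on k (\<phi> ` U) ((\<lambda>p. f p *\<^sub>R g p) \<circ> inv_into U \<phi>)"
    using bounded_bilinear.cont_diff_on[OF bounded_bilinear_scaleR D[OF f] D[OF g]] by (simp add: comp_def)
qed

lemma smooth_map_from_bounded_linear:
  assumes L: "bounded_linear L" and f: "smooth_map_from A f"
  shows "smooth_map_from A (\<lambda>p. L (f p))"
proof (rule smooth_map_fromI)
  fix U \<phi> k assume "(U, \<phi>) \<in> A"
  note D = smooth_map_fromD[OF _ this]
  show "cont_diff_on k (\<phi> ` U) ((\<lambda>p. L (f p)) \<circ> inv_into U \<phi>)"
    using bounded_linear.cont_diff_on[OF L D[OF f]] by (simp add: comp_def)
qed

lemma smooth_map_from_sum: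
  "finite I \<Longrightarrow> (\<And>i. i \<in> I \<Longrightarrow> smooth_map_from A (f i)) \<Longrightarrow> smooth_map_from A (\<lambda>p. \<Sum>i\<in>I. f i p)"
  by (induction I rule: finite_induct) (auto intro: smooth_map_from_const smooth_map_from_add)

lemma smooth_map_from_compose:
  fixes g :: "'d::euclidean_space \<Rightarrow> 'f::real_normed_vector"
  assumes g: "smooth_on UNIV g" and f: "smooth_map_from A f"
  shows "smooth_map_from A (\<lambda>p. g (f p))"
proof (rule smooth_map_fromI)
  fix U \<phi> k assume "(U, \<phi>) \<in> A"
  note D = smooth_map_fromD[OF _ this]
  show "cont_diff_on k (\<phi> ` U) ((\<lambda>p. g (f p)) \<circ> inv_into U \<phi>)"
    using cont_diff_on_compose[OF smooth_on_imp_cont_diff_on[OF g] D[OF f]] by (simp add: comp_def)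
qed

lemma smooth_on_exp_cutoff: "smooth_on U (exp_cutoff n)"
  by (simp add: smooth_on_def cont_diff_on_exp_cutoff)

section \<open>Topology, gluing and bump functions on a fixed manifold\<close>

context
  fixes X :: "'a topology" and A :: "('a, 'n::finite) chart set"
  assumes mfd: "smooth_manifold X A"
begin

lemma chart_facts:
  assumes "(U, \<phi>) \<in> A"
  shows "openin X U" "U \<subseteq> topspace X" "open (\<phi> ` U)" "inj_on \<phi> U"
    "homeomorphic_map (subtopology X U) (top_of_set (\<phi> ` U)) \<phi>"
proof -
  have *: "is_chart X (U, \<phi>)" using assms mfd by (auto simp: smooth_manifold_def smooth_atlas_def)
  then show "openin X U" "open (\<phi> ` U)" 
    and h: "homeomorphic_map (subtopology X U) (top_of_set (\<phi> ` U)) \<phi>"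
    by (auto simp: is_chart_def)
  then show U: "U \<subseteq> topspace X" using openin_subset by blast
  show "inj_on \<phi> U" using homeomorphic_imp_injective_map[OF h] U by (simp add: Int_absorb1)
qed

lemma open_chart_image:
  assumes "(U, \<phi>) \<in> A" "openin X V"
  shows "open (\<phi> ` (U \<inter> V))"
proof -
  have "openin (subtopology X U) (U \<inter> V)"
    using assms(2) by (simp add: openin_subtopology_Int2)
  then have "openin (top_of_set (\<phi> ` U)) (\<phi> ` (U \<inter> V))"
    using homeomorphic_imp_open_map[OF chart_facts(5)[OF assms(1)]] open_map_def by blast
  then show ?thesis using chart_facts(3)[OF assms(1)] openin_open_trans by blast
qed

lemma openin_chart_preimage:
  assumes "(U, \<phi>) \<in> A" "open W"
  shows "openin X {p \<in> U. \<phi> p \<in> W}"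
proof -
  note c = chart_facts[OF assms(1)]
  have "openin (subtopology X U) {p \<in> topspace (subtopology X U). \<phi> p \<in> \<phi> ` U \<inter> W}"
    by (rule openin_continuous_map_preimage[OF homeomorphic_imp_continuous_map[OF c(5)]
        openin_open_Int[OF assms(2)]])
  moreover have "{p \<in> topspace (subtopology X U). \<phi> p \<in> \<phi> ` U \<inter> W} = {p \<in> U. \<phi> p \<in> W}"
    using c(2) by auto
  ultimately show ?thesis using openin_open_subtopology[OF c(1)] by simp
qed

text \<open>Being closed in \<open>U\<close> would not suffice. The inverse chart carries the
  compact set \<open>W\<close> to a compact subset of \<open>X\<close>, and the Hausdorff property
  makes that closed.\<close>

lemma closedin_chart_preimage:
  assumes "(U, \<phi>) \<in> A" "compact W" "W \<subseteq> \<phi> ` U"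
  shows "closedin X {p \<in> U. \<phi> p \<in> W}"
proof -
  note c = chart_facts[OF assms(1)]
  obtain g where g: "homeomorphic_maps (subtopology X U) (top_of_set (\<phi> ` U)) \<phi> g"
    using c(5) homeomorphic_map_maps by blast
  have "compactin (top_of_set (\<phi> ` U)) W" using assms by (simp add: compactin_subtopology)
  then have "compactin (subtopology X U) (g ` W)"
    using g image_compactin unfolding homeomorphic_maps_def by blast
  moreover have "g ` W = {p \<in> U. \<phi> p \<in> W}"
  proof -
    have gp: "g (\<phi> p) = p" if "p \<in> U" for p
      using g that c(2) unfolding homeomorphic_maps_def by auto
    show ?thesis
    proof
      show "g ` W \<subseteq> {p \<in> U. \<phi> p \<in> W}"
      proof
        fix q assume "q \<in> g ` W"
        then obtain p where "p \<in> U" "\<phi> p \<in> W" "q = g (\<phi> p)" using assms(3) by blast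
        then show "q \<in> {p \<in> U. \<phi> p \<in> W}" using gp by simp
      qed
      show "{p \<in> U. \<phi> p \<in> W} \<subseteq> g ` W" using gp by force
    qed
  qed
  ultimately show ?thesis
    using mfd compactin_imp_closedin by (fastforce simp: compactin_subtopology smooth_manifold_def)
qed

lemma chart_transition:
  assumes "(U, \<phi>) \<in> A" "(V, \<psi>) \<in> A"
  shows "smooth_on (\<phi> ` (U \<inter> V)) (\<psi> \<circ> inv_into U \<phi>)"
proof -
  have "\<forall>(U, \<phi>)\<in>A. \<forall>(V, \<psi>)\<in>A. smooth_on (\<phi> ` (U \<inter> V)) (\<psi> \<circ> inv_into U \<phi>)"
    using mfd unfolding smooth_manifold_def smooth_atlas_def by (elim conjE)
  from bspec[OF bspec[OF this assms(1), unfolded split_conv] assms(2)] show ?thesis by simp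
qed

lemma exists_chart:
  assumes "p \<in> topspace X" obtains U \<phi> where "(U, \<phi>) \<in> A" "p \<in> U"
proof -
  have "p \<in> (\<Union>c\<in>A. fst c)"
    using mfd assms unfolding smooth_manifold_def smooth_atlas_def by simp
  then show ?thesis using that by (metis UN_E prod.collapse)
qed

text \<open>Meant for the infinite sum, which near each point coincides with one of its smooth
  partial sums.\<close>

lemma smooth_map_from_local:
  assumes "\<And>p. p \<in> topspace X \<Longrightarrow> \<exists>W g. openin X W \<and> p \<in> W \<and> smooth_map_from A g \<and> (\<forall>q\<in>W. f q = g q)"
  shows "smooth_map_from A f"
  unfolding smooth_map_from_def smooth_on_def
proof (intro ballI, clarify)
  fix U \<phi> k assume c: "(U, \<phi>) \<in> A"
  note cf = chart_facts[OF c]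
  show "cont_diff_on k (\<phi> ` U) (f \<circ> inv_into U \<phi>)"
  proof (rule cont_diff_on_local[OF cf(3)])
    fix x assume "x \<in> \<phi> ` U"
    then obtain p where p: "p \<in> U" "x = \<phi> p" by blast
    then obtain W g where W: "openin X W" "p \<in> W" "smooth_map_from A g" "\<forall>q\<in>W. f q = g q"
      using assms[of p] cf(2) by blast
    have o: "open (\<phi> ` (U \<inter> W))" by (rule open_chart_image[OF c W(1)])
    have "cont_diff_on k (\<phi> ` U) (g \<circ> inv_into U \<phi>)"
      by (rule smooth_map_fromD[OF W(3) c])
    then have "cont_diff_on k (\<phi> ` (U \<inter> W)) (g \<circ> inv_into U \<phi>)"
      by (rule cont_diff_on_subset) auto
    then have "cont_diff_on k (\<phi> ` (U \<inter> W)) (f \<circ> inv_into U \<phi>)"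
      by (rule cont_diff_on_cong[OF o, rotated]) (use W(4) cf(4) in auto)
    then have "cont_diff_on k (\<phi> ` (U \<inter> W) \<inter> \<phi> ` U) (f \<circ> inv_into U \<phi>)"
      by (rule cont_diff_on_subset) auto
    then show "\<exists>W. open W \<and> x \<in> W \<and> cont_diff_on k (W \<inter> \<phi> ` U) (f \<circ> inv_into U \<phi>)"
      using o p W(2) by (intro exI[of _ "\<phi> ` (U \<inter> W)"]) auto
  qed
qed

text \<open>The open sets \<open>U\<close> and \<open>topspace X - K\<close> cover the manifold. On
  the first, \<open>f\<close> is its expression in the chart composed with a smooth transition map;
  on the second it is 0.\<close>

lemma smooth_map_from_extend:
  assumes c: "(U, \<phi>) \<in> A" and K: "closedin X K" "K \<subseteq> U"
    and f0: "\<And>p. p \<notin> K \<Longrightarrow> f p = 0" and f: "smooth_on (\<phi> ` U) (f \<circ> inv_into U \<phi>)"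
  shows "smooth_map_from A f"
  unfolding smooth_map_from_def smooth_on_def
proof (intro ballI, clarify)
  fix V \<psi> k assume d: "(V, \<psi>) \<in> A"
  note cf = chart_facts[OF c] and df = chart_facts[OF d]
  show "cont_diff_on k (\<psi> ` V) (f \<circ> inv_into V \<psi>)"
  proof (rule cont_diff_on_local[OF df(3)])
    fix x assume "x \<in> \<psi> ` V"
    then obtain p where p: "p \<in> V" "x = \<psi> p" by blast
    have "\<exists>W. openin X W \<and> p \<in> W \<and> cont_diff_on k (\<psi> ` (V \<inter> W)) (f \<circ> inv_into V \<psi>)"
    proof (cases "p \<in> U")
      case True
      have t: "cont_diff_on k (\<psi> ` (V \<inter> U)) (\<phi> \<circ> inv_into V \<psi>)"
        using chart_transition[OF d c] by (simp add: smooth_on_def)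
      have "cont_diff_on k (\<psi> ` (V \<inter> U)) (\<lambda>x. (f \<circ> inv_into U \<phi>) ((\<phi> \<circ> inv_into V \<psi>) x))"
        by (rule cont_diff_on_compose[OF smooth_on_imp_cont_diff_on[OF f] t]) (use df(4) in auto)
      then have "cont_diff_on k (\<psi> ` (V \<inter> U)) (f \<circ> inv_into V \<psi>)"
        by (rule cont_diff_on_cong[OF open_chart_image[OF d cf(1)], rotated]) (use cf(4) df(4) in auto)
      then show ?thesis using True cf(1) by blast
    next
      case False
      have o: "openin X (topspace X - K)" using K(1) by blast
      have "cont_diff_on k (\<psi> ` (V \<inter> (topspace X - K))) (f \<circ> inv_into V \<psi>)"
        by (rule cont_diff_on_cong[OF open_chart_image[OF d o] _ cont_diff_on_const[of _ _ 0]])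
          (use f0 df(4) in auto)
      then show ?thesis using False K(2) o p df(2) by blast
    qed
    then obtain W where W: "openin X W" "p \<in> W" "cont_diff_on k (\<psi> ` (V \<inter> W)) (f \<circ> inv_into V \<psi>)"
      by blast
    then show "\<exists>W. open W \<and> x \<in> W \<and> cont_diff_on k (W \<inter> \<psi> ` V) (f \<circ> inv_into V \<psi>)"
      using open_chart_image[OF d W(1)] p cont_diff_on_subset[OF W(3), of "\<psi> ` (V \<inter> W) \<inter> \<psi> ` V"]
      by (intro exI[of _ "\<psi> ` (V \<inter> W)"]) auto
  qed
qed

lemma openin_smooth_preimage:
  assumes f: "smooth_map_from A f" and O: "open T"
  shows "openin X {p \<in> topspace X. f p \<in> T}"
proof (subst openin_subopen, clarify)
  fix p assume p: "p \<in> topspace X" "f p \<in> T"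
  obtain U \<phi> where c: "(U, \<phi>) \<in> A" "p \<in> U" by (rule exists_chart[OF p(1)])
  note cf = chart_facts[OF c(1)]
  have "continuous_on (\<phi> ` U) (f \<circ> inv_into U \<phi>)"
    using smooth_map_fromD[OF f c(1)] cont_diff_on_imp_continuous_on by blast
  then have "open (\<phi> ` U \<inter> (f \<circ> inv_into U \<phi>) -` T)"
    using cf(3) O continuous_open_preimage by blast
  then have "openin X {q \<in> U. \<phi> q \<in> \<phi> ` U \<inter> (f \<circ> inv_into U \<phi>) -` T}"
    by (rule openin_chart_preimage[OF c(1)])
  moreover have "{q \<in> U. \<phi> q \<in> \<phi> ` U \<inter> (f \<circ> inv_into U \<phi>) -` T} = {q \<in> U. f q \<in> T}"
  proof (rule Collect_cong, rule conj_cong[OF refl])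
    fix q assume q: "q \<in> U"
    have "(f \<circ> inv_into U \<phi>) (\<phi> q) = f q" by (simp only: comp_def inv_into_f_f[OF cf(4) q])
    then show "\<phi> q \<in> \<phi> ` U \<inter> (f \<circ> inv_into U \<phi>) -` T \<longleftrightarrow> f q \<in> T"
      unfolding Int_iff vimage_eq using q by (metis imageI)
  qed
  ultimately have "openin X {q \<in> U. f q \<in> T}" by (simp only:)
  then show "\<exists>W. openin X W \<and> p \<in> W \<and> W \<subseteq> {p \<in> topspace X. f p \<in> T}"
    using c(2) p(2) cf(2) by (intro exI[of _ "{q \<in> U. f q \<in> T}"]) auto
qed

text \<open>
  Smoothness of \<open>\<rho>\<close> times a coordinate expresses that the support of \<open>\<rho>\<close> stays away from the
  boundary of the chart domain, where the coordinates have arbitrary values.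
\<close>

definition bump :: "('a, 'n) chart \<Rightarrow> ('a \<Rightarrow> real) \<Rightarrow> bool"
  where "bump c \<rho> \<longleftrightarrow> c \<in> A \<and> smooth_map_from A \<rho> \<and> (\<forall>q. q \<notin> fst c \<longrightarrow> \<rho> q = 0) \<and>
    (\<forall>l. smooth_map_from A (\<lambda>q. \<rho> q * snd c q $ l))"

lemma exists_bump:
  assumes "p \<in> topspace X" shows "\<exists>c \<rho>. bump c \<rho> \<and> \<rho> p > 1"
proof -
  obtain U \<phi> where c: "(U, \<phi>) \<in> A" "p \<in> U" by (rule exists_chart[OF assms])
  note cf = chart_facts[OF c(1)]
  obtain r where r: "r > 0" "cball (\<phi> p) r \<subseteq> \<phi> ` U"
    using cf(3) c(2) by (meson open_contains_cball imageI)
  define K where "K = {q \<in> U. \<phi> q \<in> cball (\<phi> p) r}"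
  have K: "closedin X K" "K \<subseteq> U"
    unfolding K_def using closedin_chart_preimage[OF c(1) compact_cball r(2)] by blast+
  \<comment> \<open>A radial bump in coordinates: it vanishes at distance at least \<open>r\<close>
    from \<open>\<phi> p\<close>, and the factor in front normalises its value at the centre to 2,
    which exceeds 1.\<close>
  define b where "b = (\<lambda>y. 2 / exp_cutoff 0 (r\<^sup>2) * exp_cutoff 0 (r\<^sup>2 + - ((y + - \<phi> p) \<bullet> (y + - \<phi> p))))"
  have b: "cont_diff_on k W b" for k W
  proof -
    have "cont_diff_on k W (\<lambda>y. y + - \<phi> p)"
      by (intro cont_diff_on_add cont_diff_on_ident cont_diff_on_const)
    then have "cont_diff_on k W (\<lambda>y. (y + - \<phi> p) \<bullet> (y + - \<phi> p))"
      by (intro bounded_bilinear.cont_diff_on[OF bounded_bilinear_inner])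
    then have "cont_diff_on k W (\<lambda>y. r\<^sup>2 + - ((y + - \<phi> p) \<bullet> (y + - \<phi> p)))"
      by (intro cont_diff_on_add cont_diff_on_const
          bounded_linear.cont_diff_on[OF bounded_linear_minus[OF bounded_linear_ident]])
    from cont_diff_on_compose[OF cont_diff_on_exp_cutoff[of k UNIV 0] this] show ?thesis
      unfolding b_def by (intro bounded_linear.cont_diff_on[OF bounded_linear_mult_right]) simp
  qed
  have b0: "b y = 0" if "y \<notin> cball (\<phi> p) r" for y
  proof -
    have "r\<^sup>2 \<le> (norm (y - \<phi> p))\<^sup>2" using that r(1)
      by (intro power_mono) (auto simp: dist_norm norm_minus_commute)
    then show ?thesis by (simp add: b_def exp_cutoff_def dot_square_norm)
  qed
  \<comment> \<open>Taking \<open>h\<close> to be 1 gives smoothness of \<rho>; taking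
    \<open>h\<close> to be a coordinate gives smoothness of \<rho> times that coordinate.\<close>
  have ext: "smooth_map_from A (\<lambda>q. if q \<in> U then b (\<phi> q) * h (\<phi> q) else 0)"
    if h: "\<And>k. cont_diff_on k UNIV h" for h :: "real ^ 'n \<Rightarrow> real"
  proof (rule smooth_map_from_extend[OF c(1) K])
    show "smooth_on (\<phi> ` U) ((\<lambda>q. if q \<in> U then b (\<phi> q) * h (\<phi> q) else 0) \<circ> inv_into U \<phi>)"
      unfolding smooth_on_def
    proof
      fix k
      have "cont_diff_on k (\<phi> ` U) (\<lambda>y. b y * h y)"
        by (intro bounded_bilinear.cont_diff_on[OF bounded_bilinear_mult] b cont_diff_on_subset[OF h]) auto
      then show "cont_diff_on k (\<phi> ` U) ((\<lambda>q. if q \<in> U then b (\<phi> q) * h (\<phi> q) else 0) \<circ> inv_into U \<phi>)"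
        by (rule cont_diff_on_cong[OF cf(3), rotated]) (use cf(4) in auto)
    qed
  qed (auto simp: K_def b0)
  define \<rho> where "\<rho> = (\<lambda>q. if q \<in> U then b (\<phi> q) else 0)"
  have "\<rho> p = 2" using c(2) r(1) by (simp add: \<rho>_def b_def exp_cutoff_def)
  moreover have "smooth_map_from A \<rho>" 
    using ext[OF cont_diff_on_const, of 1] by (simp only: \<rho>_def mult_1_right)
  moreover have "smooth_map_from A (\<lambda>q. \<rho> q * \<phi> q $ l)" for l
  proof -
    have eq: "(\<lambda>q. \<rho> q * \<phi> q $ l) = (\<lambda>q. if q \<in> U then b (\<phi> q) * \<phi> q $ l else 0)"
      by (simp add: \<rho>_def fun_eq_iff)
    have "cont_diff_on k UNIV (\<lambda>y. y $ l)" for k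
      by (intro bounded_linear.cont_diff_on[OF bounded_linear_vec_nth] cont_diff_on_ident)
    from ext[OF this] show ?thesis unfolding eq .
  qed
  moreover have "\<rho> q = 0" if "q \<notin> U" for q using that by (simp add: \<rho>_def)
  ultimately have "bump (U, \<phi>) \<rho> \<and> \<rho> p > 1" using c(1) by (simp add: bump_def)
  then show ?thesis by blast
qed

text \<open>Second countability makes \<open>X\<close> a Lindelof space, so countably many of the
  open sets on which a chosen bump exceeds 1 already cover it. A point of \<open>X\<close> is needed
  to list them as a sequence, possibly with repetitions.\<close>

lemma exists_bump_sequence:
  assumes "topspace X \<noteq> {}"
  shows "\<exists>c \<rho>. (\<forall>j::nat. bump (c j) (\<rho> j)) \<and> (\<forall>p\<in>topspace X. \<exists>j. \<rho> j p > 1)"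
proof -
  have "\<forall>p\<in>topspace X. \<exists>z. bump (fst z) (snd z) \<and> snd z p > 1"
    using exists_bump by simp
  from bchoice[OF this] obtain z where
    b: "\<And>p. p \<in> topspace X \<Longrightarrow> bump (fst (z p)) (snd (z p)) \<and> snd (z p) p > 1" by blast
  define W where "W = (\<lambda>p. {q \<in> topspace X. snd (z p) q \<in> {1<..}})"
  have "openin X (W p)" if "p \<in> topspace X" for p
    unfolding W_def using b[OF that] by (intro openin_smooth_preimage) (auto simp: bump_def)
  then have op: "\<And>V. V \<in> W ` topspace X \<Longrightarrow> openin X V" by blast
  have un: "\<Union>(W ` topspace X) = topspace X" using b by (auto simp: W_def)
  have L: "Lindelof_space X"
    using mfd second_countable_imp_Lindelof_space unfolding smooth_manifold_def by blast
  have "\<exists>\<V>. countable \<V> \<and> \<V> \<subseteq> W ` topspace X \<and> \<Union>\<V> = topspace X"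
    by (rule Lindelof_spaceD[OF L _ un]) (rule op)
  then obtain \<V> where "countable \<V> \<and> \<V> \<subseteq> W ` topspace X \<and> \<Union>\<V> = topspace X"
    by (elim exE) (rule that)
  then have V: "countable \<V> \<and> \<V> \<subseteq> W ` topspace X" "\<Union>\<V> = topspace X" by simp_all
  from V(1) obtain Q where Q: "countable Q" "Q \<subseteq> topspace X" "\<V> = W ` Q"
    unfolding countable_subset_image by (elim exE conjE) (rule that)
  have "Q \<noteq> {}" using V(2) assms unfolding Q(3) by (metis Union_empty image_empty)
  then have f: "range (from_nat_into Q) = Q" by (rule range_from_nat_into[OF _ Q(1)])
  define f where "f = from_nat_into Q"
  have fQ: "f j \<in> topspace X" for j using from_nat_into[of Q j] \<open>Q \<noteq> {}\<close> Q(2) unfolding f_def by blast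
  show ?thesis
  proof (intro exI[of _ "\<lambda>j. fst (z (f j))"] exI[of _ "\<lambda>j. snd (z (f j))"] conjI allI ballI)
    show "bump (fst (z (f j))) (snd (z (f j)))" for j using b[OF fQ] by simp
    fix p assume "p \<in> topspace X"
    then obtain q where q: "q \<in> Q" "p \<in> W q" using V(2) unfolding Q(3) by blast
    then obtain j where "q = f j" using f unfolding f_def by (metis imageE)
    then show "\<exists>j. 1 < snd (z (f j)) p" using q(2) by (auto simp: W_def)
  qed
qed

end

section \<open>Independent differentials\<close>

text \<open>The wedge product involves the whole index type at once, whereas functions are added one
  at a time; linear independence of a subfamily \<open>S\<close> is the form that suits this
  induction.\<close>

definition independent_differentials ::
  "('a, 'n::finite) chart \<Rightarrow> ('m \<Rightarrow> 'a \<Rightarrow> complex) \<Rightarrow> 'm set \<Rightarrow> 'a \<Rightarrow> bool"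
  where "independent_differentials c F S p \<longleftrightarrow>
    (\<forall>a. (\<forall>v. (\<Sum>k\<in>S. a k * differential c (F k) p v) = 0) \<longrightarrow> (\<forall>k\<in>S. a k = 0))"

lemma independent_differentials_insert:
  assumes S: "finite S" "s \<notin> S" and F: "independent_differentials c F S p"
    and h: "\<And>a. \<exists>v. differential c h p v \<noteq> (\<Sum>k\<in>S. a k * differential c (F k) p v)"
  shows "independent_differentials c (F(s := h)) (insert s S) p"
  unfolding independent_differentials_def
proof (intro allI impI)
  fix a assume a: "\<forall>v. (\<Sum>k\<in>insert s S. a k * differential c ((F(s := h)) k) p v) = 0"
  have sum: "(\<Sum>k\<in>insert s S. a k * differential c ((F(s := h)) k) p v) =
      a s * differential c h p v + (\<Sum>k\<in>S. a k * differential c (F k) p v)" for v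
  proof -
    have "(\<Sum>k\<in>S. a k * differential c ((F(s := h)) k) p v) = (\<Sum>k\<in>S. a k * differential c (F k) p v)"
      using S(2) by (intro sum.cong) auto
    then show ?thesis using S by simp
  qed
  have as: "a s = 0"
  proof (rule ccontr)
    assume n: "a s \<noteq> 0"
    obtain v where v: "differential c h p v \<noteq> (\<Sum>k\<in>S. (- a k / a s) * differential c (F k) p v)"
      using h[of "\<lambda>k. - a k / a s"] by blast
    have "(\<Sum>k\<in>S. (- a k / a s) * differential c (F k) p v) =
        - (\<Sum>k\<in>S. a k * differential c (F k) p v) / a s"
      by (simp add: sum_divide_distrib sum_negf)
    also have "(\<Sum>k\<in>S. a k * differential c (F k) p v) = - (a s * differential c h p v)"
      using a[rule_format, of v] unfolding sum by (simp add: eq_neg_iff_add_eq_0 add.commute)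
    finally show False using v n by simp
  qed
  then have "\<forall>k\<in>S. a k = 0"
    using a F unfolding sum independent_differentials_def by simp
  with as show "\<forall>k\<in>insert s S. a k = 0" by simp
qed

section \<open>Differentials in charts and change of chart\<close>

context
  fixes X :: "'a topology" and A :: "('a, 'n::finite) chart set"
  assumes mfd: "smooth_manifold X A"
begin

lemma differential_has_derivative:
  assumes "smooth_map_from A f" "(U, \<phi>) \<in> A" "p \<in> U"
  shows "((f \<circ> inv_into U \<phi>) has_derivative differential (U, \<phi>) f p) (at (\<phi> p))"
  unfolding differential_def split_conv
  by (rule cont_diff_on_Suc_has_derivative[OF chart_facts(3)[OF mfd assms(2)]
      smooth_map_fromD[OF assms(1,2)] imageI[OF assms(3)]])

lemma differential_eqI:
  "((f \<circ> inv_into U \<phi>) has_derivative D) (at (\<phi> p)) \<Longrightarrow> differential (U, \<phi>) f p = D"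
  unfolding differential_def split_conv by (rule frechet_derivative_at[symmetric])

lemma differential_add:
  assumes f: "smooth_map_from A f" and g: "smooth_map_from A g" and c: "(U, \<phi>) \<in> A" "p \<in> U"
  shows "differential (U, \<phi>) (\<lambda>q. f q + g q) p =
    (\<lambda>v. differential (U, \<phi>) f p v + differential (U, \<phi>) g p v)"
  by (rule differential_eqI)
    (use has_derivative_add[OF differential_has_derivative[OF f c] differential_has_derivative[OF g c]]
      in \<open>simp add: comp_def\<close>)

lemma differential_scaleR:
  assumes f: "smooth_map_from A f" and g: "smooth_map_from A g" and c: "(U, \<phi>) \<in> A" "p \<in> U"
  shows "differential (U, \<phi>) (\<lambda>q. f q *\<^sub>R g q) p =
    (\<lambda>v. f p *\<^sub>R differential (U, \<phi>) g p v + differential (U, \<phi>) f p v *\<^sub>R g p)"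
proof (rule differential_eqI)
  show "(((\<lambda>q. f q *\<^sub>R g q) \<circ> inv_into U \<phi>) has_derivative
      (\<lambda>v. f p *\<^sub>R differential (U, \<phi>) g p v + differential (U, \<phi>) f p v *\<^sub>R g p)) (at (\<phi> p))"
    using has_derivative_scaleR[OF differential_has_derivative[OF f c] differential_has_derivative[OF g c]]
      inv_into_f_f[OF chart_facts(4)[OF mfd c(1)] c(2)]
    by (simp add: comp_def)
qed

lemma differential_cong:
  assumes c: "(U, \<phi>) \<in> A" "p \<in> U" and W: "openin X W" "p \<in> W" "\<And>q. q \<in> W \<Longrightarrow> f q = g q"
  shows "differential (U, \<phi>) f p = differential (U, \<phi>) g p"
  unfolding differential_def split_conv
proof (rule frechet_derivative_cong_open[OF open_chart_image[OF mfd c(1) W(1)]])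
  show "\<phi> p \<in> \<phi> ` (U \<inter> W)" using c(2) W(2) by blast
  fix y assume "y \<in> \<phi> ` (U \<inter> W)"
  then obtain q where q: "q \<in> U" "q \<in> W" "y = \<phi> q" by blast
  then show "(f \<circ> inv_into U \<phi>) y = (g \<circ> inv_into U \<phi>) y"
    using W(3)[OF q(2)] inv_into_f_f[OF chart_facts(4)[OF mfd c(1)] q(1)] by simp
qed

lemma differential_change_chart:
  assumes f: "smooth_map_from A f" and c: "(U, \<phi>) \<in> A" "p \<in> U" and d: "(V, \<psi>) \<in> A" "p \<in> V"
  shows "differential (U, \<phi>) f p v =
    differential (V, \<psi>) f p (frechet_derivative (\<psi> \<circ> inv_into U \<phi>) (at (\<phi> p)) v)"
proof -
  note cf = chart_facts[OF mfd c(1)] and df = chart_facts[OF mfd d(1)]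
  have o: "open (\<phi> ` (U \<inter> V))" by (rule open_chart_image[OF mfd c(1) df(1)])
  have ip: "inv_into U \<phi> (\<phi> q) = q" if "q \<in> U" for q by (rule inv_into_f_f[OF cf(4) that])
  have "((\<psi> \<circ> inv_into U \<phi>) has_derivative frechet_derivative (\<psi> \<circ> inv_into U \<phi>) (at (\<phi> p))) (at (\<phi> p))"
    by (rule cont_diff_on_Suc_has_derivative[OF o smooth_on_imp_cont_diff_on[OF chart_transition[OF mfd c(1) d(1)]]])
      (use c(2) d(2) in blast)
  moreover have "((f \<circ> inv_into V \<psi>) has_derivative differential (V, \<psi>) f p) (at ((\<psi> \<circ> inv_into U \<phi>) (\<phi> p)))"
    using differential_has_derivative[OF f d] by (simp add: ip[OF c(2)])
  ultimately have "(((f \<circ> inv_into V \<psi>) \<circ> (\<psi> \<circ> inv_into U \<phi>)) has_derivative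
      (differential (V, \<psi>) f p \<circ> frechet_derivative (\<psi> \<circ> inv_into U \<phi>) (at (\<phi> p)))) (at (\<phi> p))"
    by (rule diff_chain_at)
  then have "((f \<circ> inv_into U \<phi>) has_derivative
      (differential (V, \<psi>) f p \<circ> frechet_derivative (\<psi> \<circ> inv_into U \<phi>) (at (\<phi> p)))) (at (\<phi> p))"
  proof (rule has_derivative_transform_within_open[OF _ o])
    show "\<phi> p \<in> \<phi> ` (U \<inter> V)" using c(2) d(2) by blast
    fix y assume "y \<in> \<phi> ` (U \<inter> V)"
    then obtain q where q: "q \<in> U" "q \<in> V" "y = \<phi> q" by blast
    then show "((f \<circ> inv_into V \<psi>) \<circ> (\<psi> \<circ> inv_into U \<phi>)) y = (f \<circ> inv_into U \<phi>) y"
      using ip[OF q(1)] inv_into_f_f[OF df(4) q(2)] by simp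
  qed
  from differential_eqI[OF this] show ?thesis by simp
qed

text \<open>The differentials in \<open>(U, \<phi>)\<close> are those in \<open>(V, \<psi>)\<close>
  precomposed with one common linear map, so a relation in \<open>(V, \<psi>)\<close> is a relation
  in \<open>(U, \<phi>)\<close> with the same coefficients.\<close>

lemma independent_differentials_change_chart:
  assumes F: "\<And>k. k \<in> S \<Longrightarrow> smooth_map_from A (F k)"
    and c: "(U, \<phi>) \<in> A" "p \<in> U" and d: "(V, \<psi>) \<in> A" "p \<in> V"
    and i: "independent_differentials (U, \<phi>) F S p"
  shows "independent_differentials (V, \<psi>) F S p"
  unfolding independent_differentials_def
proof (intro allI impI)
  fix a assume a: "\<forall>v. (\<Sum>k\<in>S. a k * differential (V, \<psi>) (F k) p v) = 0"
  have "(\<Sum>k\<in>S. a k * differential (U, \<phi>) (F k) p v) = (\<Sum>k\<in>S. a k *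
      differential (V, \<psi>) (F k) p (frechet_derivative (\<psi> \<circ> inv_into U \<phi>) (at (\<phi> p)) v))" for v
    by (intro sum.cong refl) (simp only: differential_change_chart[OF F c d])
  then show "\<forall>k\<in>S. a k = 0" using a i unfolding independent_differentials_def by metis
qed

section \<open>Adding one function to an independent family\<close>

lemma chart_perturbation_avoids_span:
  fixes F :: "'m::finite \<Rightarrow> 'a \<Rightarrow> complex"
  assumes c: "(U, \<phi>) \<in> A" and h: "smooth_map_from A h" and g: "smooth_map_from A g"
    and F: "\<And>k. k \<in> S \<Longrightarrow> smooth_map_from A (F k)"
    and s: "s \<notin> S" and dim: "2 * CARD('m) \<le> CARD('n) + 1"
  shows "\<exists>\<alpha> \<beta>. \<forall>p\<in>U. g p \<noteq> 0 \<longrightarrow> (\<forall>a. \<exists>v.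
    differential (U, \<phi>) (\<lambda>q. h q + g q *\<^sub>R ((\<Sum>l\<in>UNIV. \<phi> q $ l *\<^sub>R \<alpha> l) + \<beta>)) p v \<noteq>
    (\<Sum>k\<in>S. a k * differential (U, \<phi>) (F k) p v))"
proof -
  note cf = chart_facts[OF mfd c]
  let ?i = "inv_into U \<phi>"
  have "\<exists>\<alpha> \<beta>. \<forall>x\<in>\<phi> ` U. (g \<circ> ?i) x \<noteq> 0 \<longrightarrow> (\<forall>a. \<exists>v.
      frechet_derivative (\<lambda>x. (h \<circ> ?i) x + (g \<circ> ?i) x *\<^sub>R ((\<Sum>l\<in>UNIV. x $ l *\<^sub>R \<alpha> l) + \<beta>)) (at x) v \<noteq>
      (\<Sum>k\<in>S. a k * frechet_derivative (F k \<circ> ?i) (at x) v))"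
    by (rule affine_perturbation_avoids_span[OF cf(3) smooth_map_fromD[OF h c] smooth_map_fromD[OF g c] _ s dim])
      (rule smooth_map_fromD[OF F c])
  then obtain \<alpha> \<beta> where ab: "\<forall>x\<in>\<phi> ` U. (g \<circ> ?i) x \<noteq> 0 \<longrightarrow> (\<forall>a. \<exists>v.
      frechet_derivative (\<lambda>x. (h \<circ> ?i) x + (g \<circ> ?i) x *\<^sub>R ((\<Sum>l\<in>UNIV. x $ l *\<^sub>R \<alpha> l) + \<beta>)) (at x) v \<noteq>
      (\<Sum>k\<in>S. a k * frechet_derivative (F k \<circ> ?i) (at x) v))"
    by (elim exE) (rule that)
  show ?thesis
  proof (intro exI[of _ \<alpha>] exI[of _ \<beta>] ballI impI allI)
    fix p and a :: "'m \<Rightarrow> complex" assume p: "p \<in> U" "g p \<noteq> 0"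
    have ip: "?i (\<phi> q) = q" if "q \<in> U" for q by (rule inv_into_f_f[OF cf(4) that])
    have "frechet_derivative ((\<lambda>q. h q + g q *\<^sub>R ((\<Sum>l\<in>UNIV. \<phi> q $ l *\<^sub>R \<alpha> l) + \<beta>)) \<circ> ?i) (at (\<phi> p)) =
      frechet_derivative (\<lambda>x. (h \<circ> ?i) x + (g \<circ> ?i) x *\<^sub>R ((\<Sum>l\<in>UNIV. x $ l *\<^sub>R \<alpha> l) + \<beta>)) (at (\<phi> p))"
      by (rule frechet_derivative_cong_open[OF cf(3) imageI[OF p(1)]]) (auto simp: ip)
    moreover have "(g \<circ> ?i) (\<phi> p) \<noteq> 0" using p by (simp add: ip)
    ultimately show "\<exists>v. differential (U, \<phi>) (\<lambda>q. h q + g q *\<^sub>R ((\<Sum>l\<in>UNIV. \<phi> q $ l *\<^sub>R \<alpha> l) + \<beta>)) p v \<noteq>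
      (\<Sum>k\<in>S. a k * differential (U, \<phi>) (F k) p v)"
      using ab[rule_format, OF imageI[OF p(1)], of a] unfolding differential_def split_conv by simp
  qed
qed

lemma extend_independent_differentials:
  fixes F :: "'m::finite \<Rightarrow> 'a \<Rightarrow> complex"
  assumes F: "\<And>k. k \<in> S \<Longrightarrow> smooth_map_from A (F k)"
    and indep: "\<And>c p. c \<in> A \<Longrightarrow> p \<in> fst c \<Longrightarrow> independent_differentials c F S p"
    and s: "s \<notin> S" and dim: "2 * CARD('m) \<le> CARD('n) + 1" and ne: "topspace X \<noteq> {}"
  shows "\<exists>H. smooth_map_from A H \<and>
    (\<forall>c\<in>A. \<forall>p\<in>fst c. independent_differentials c (F(s := H)) (insert s S) p)"
proof -
  obtain c \<rho> where b: "\<And>j::nat. bump A (c j) (\<rho> j)" and cov: "\<And>p. p \<in> topspace X \<Longrightarrow> \<exists>j. \<rho> j p > 1"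
    using exists_bump_sequence[OF mfd ne] by metis
  have cA: "c j \<in> A" and sm\<rho>: "smooth_map_from A (\<rho> j)" and supp: "q \<notin> fst (c j) \<Longrightarrow> \<rho> j q = 0"
    and sm\<phi>: "smooth_map_from A (\<lambda>q. \<rho> j q * snd (c j) q $ l)" for j q l
    using b[of j] unfolding bump_def[OF mfd] by blast+
  \<comment> \<open>Positive exactly where \<open>\<rho> j q < 1\<close>, and flat at the boundary
    \<open>\<rho> j q = 1\<close>, so that the differential vanishes there too.\<close>
  define \<eta> where "\<eta> = (\<lambda>j q. exp_cutoff 0 (1 + - \<rho> j q))"
  define T where "T = (\<lambda>k q. \<Prod>i<k. \<eta> i q)"
  have T_Suc: "T (Suc k) = (\<lambda>q. T k q *\<^sub>R \<eta> k q)" for k by (simp add: T_def fun_eq_iff)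
  have sm\<eta>: "smooth_map_from A (\<eta> j)" for j
    unfolding \<eta>_def
    by (intro smooth_map_from_compose[OF smooth_on_exp_cutoff] smooth_map_from_add smooth_map_from_const
        smooth_map_from_bounded_linear[OF bounded_linear_minus[OF bounded_linear_ident]] sm\<rho>)
  have smT: "smooth_map_from A (T k)" for k
  proof (induction k)
    case 0 show ?case by (simp add: T_def smooth_map_from_const)
  next
    case (Suc k) show ?case unfolding T_Suc by (rule smooth_map_from_scaleR[OF Suc sm\<eta>])
  qed
  \<comment> \<open>The two facts kept about step \<open>j\<close>: the increment is a smooth
    multiple of \<open>T j\<close>, which later makes it vanish to first order, and the new partial
    sum has a differential outside the given span wherever \<open>T j * \<rho> j\<close> is nonzero
    on the chart domain.\<close>
  define R where "R = (\<lambda>j h h'. (\<exists>u. smooth_map_from A u \<and> h' = (\<lambda>q. h q + T j q *\<^sub>R u q)) \<and>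
    (\<forall>p\<in>fst (c j). T j p * \<rho> j p \<noteq> 0 \<longrightarrow>
      (\<forall>a. \<exists>v. differential (c j) h' p v \<noteq> (\<Sum>k\<in>S. a k * differential (c j) (F k) p v))))"
  \<comment> \<open>The good parameters at step \<open>j\<close> depend on the partial sum reached
    so far, hence dependent choice; the start \<open>Hs 0\<close> may be any smooth
    function.\<close>
  have "\<exists>Hs. \<forall>j. smooth_map_from A (Hs j) \<and> R j (Hs j) (Hs (Suc j))"
  proof (rule dependent_nat_choice[of "\<lambda>_. smooth_map_from A" R])
    show "\<exists>h. smooth_map_from A (h :: 'a \<Rightarrow> complex)" using smooth_map_from_const by blast
    fix h :: "'a \<Rightarrow> complex" and j assume h: "smooth_map_from A h"
    obtain U \<phi> where cj: "c j = (U, \<phi>)" by fastforce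
    have g: "smooth_map_from A (\<lambda>q. T j q *\<^sub>R \<rho> j q)" by (rule smooth_map_from_scaleR[OF smT sm\<rho>])
    have "\<exists>\<alpha> \<beta>. \<forall>p\<in>U. T j p *\<^sub>R \<rho> j p \<noteq> 0 \<longrightarrow> (\<forall>a. \<exists>v.
      differential (U, \<phi>) (\<lambda>q. h q + (T j q *\<^sub>R \<rho> j q) *\<^sub>R ((\<Sum>l\<in>UNIV. \<phi> q $ l *\<^sub>R \<alpha> l) + \<beta>)) p v \<noteq>
      (\<Sum>k\<in>S. a k * differential (U, \<phi>) (F k) p v))"
      by (rule chart_perturbation_avoids_span[OF cA[of j, unfolded cj] h g _ s dim]) (rule F)
    then obtain \<alpha> \<beta> where ab: "\<forall>p\<in>U. T j p *\<^sub>R \<rho> j p \<noteq> 0 \<longrightarrow> (\<forall>a. \<exists>v.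
      differential (U, \<phi>) (\<lambda>q. h q + (T j q *\<^sub>R \<rho> j q) *\<^sub>R ((\<Sum>l\<in>UNIV. \<phi> q $ l *\<^sub>R \<alpha> l) + \<beta>)) p v \<noteq>
      (\<Sum>k\<in>S. a k * differential (U, \<phi>) (F k) p v))"
      by (elim exE) (rule that)
    \<comment> \<open>Moving \<open>\<rho> j\<close> inside the affine function makes each summand
      globally smooth, although \<open>\<phi>\<close> is meaningful on \<open>U\<close>
      only.\<close>
    define u where "u = (\<lambda>q. (\<Sum>l\<in>UNIV. (\<rho> j q * \<phi> q $ l) *\<^sub>R \<alpha> l) + \<rho> j q *\<^sub>R \<beta>)"
    define h' where "h' = (\<lambda>q. h q + T j q *\<^sub>R u q)"
    have eq: "h' = (\<lambda>q. h q + (T j q *\<^sub>R \<rho> j q) *\<^sub>R ((\<Sum>l\<in>UNIV. \<phi> q $ l *\<^sub>R \<alpha> l) + \<beta>))"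
      by (simp add: h'_def u_def fun_eq_iff scaleR_right_distrib scaleR_sum_right mult.assoc)
    have u: "smooth_map_from A u"
      unfolding u_def using sm\<phi>[of j] unfolding cj snd_conv
      by (intro smooth_map_from_add smooth_map_from_sum smooth_map_from_scaleR finite
          smooth_map_from_const sm\<rho>)
    have "R j h h'"
      unfolding R_def cj fst_conv
    proof
      show "\<exists>u. smooth_map_from A u \<and> h' = (\<lambda>q. h q + T j q *\<^sub>R u q)" using u h'_def by blast
    qed (use ab in \<open>simp only: flip: eq real_scaleR_def\<close>)
    moreover have "smooth_map_from A h'"
      unfolding h'_def by (intro smooth_map_from_add smooth_map_from_scaleR h u smT)
    ultimately show "\<exists>h'. smooth_map_from A h' \<and> R j h h'" by blast
  qed
  then obtain Hs where smH: "\<And>j. smooth_map_from A (Hs j)" and HR: "\<And>j. R j (Hs j) (Hs (Suc j))"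
    by (elim exE) (blast intro: that)
  have "\<exists>u. smooth_map_from A u \<and> Hs (Suc j) = (\<lambda>q. Hs j q + T j q *\<^sub>R u q)" for j
    using HR[of j] unfolding R_def by (rule conjunct1)
  then obtain u where smu: "\<And>j. smooth_map_from A (u j)"
    and Hs_Suc: "\<And>j. Hs (Suc j) = (\<lambda>q. Hs j q + T j q *\<^sub>R u j q)" by metis
  have T0: "T k p = 0" if "j < k" "\<rho> j p \<ge> 1" for j k p
    unfolding T_def by (rule prod_zero) (use that in \<open>auto simp: \<eta>_def exp_cutoff_def intro!: bexI[of _ j]\<close>)
  \<comment> \<open>The index is \<open>Suc j\<close> because term \<open>j\<close> itself may be
    nonzero at \<open>p\<close>; only the terms after it contain the factor
    \<open>\<eta> j\<close>.\<close>
  have stable: "Hs k p = Hs (Suc j) p" if "Suc j \<le> k" "\<rho> j p \<ge> 1" for j k p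
    using that(1) by (induction k rule: dec_induct) (use T0[OF _ that(2)] in \<open>simp_all add: Hs_Suc\<close>)
  \<comment> \<open>The pointwise limit of the partial sums. By \<open>stable\<close> every index
    with \<open>\<rho> j p > 1\<close> gives the same value; the strict inequality makes the sets
    \<open>V l\<close> open, so that \<open>H\<close> is a fixed partial sum on each of
    them.\<close>
  define H where "H = (\<lambda>p. Hs (Suc (LEAST j. \<rho> j p > 1)) p)"
  define V where "V = (\<lambda>l. {p \<in> topspace X. \<rho> l p \<in> {1<..}})"
  have opV: "openin X (V l)" for l unfolding V_def by (rule openin_smooth_preimage[OF mfd sm\<rho>]) simp
  have HV: "H p = Hs (Suc l) p" if "p \<in> V l" for p l
  proof -
    have l: "\<rho> l p > 1" using that by (simp add: V_def)
    then have "(LEAST j. \<rho> j p > 1) \<le> l" by (rule Least_le)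
    moreover have "\<rho> (LEAST j. \<rho> j p > 1) p > 1" using l by (rule LeastI)
    ultimately show ?thesis using stable[of "LEAST j. \<rho> j p > 1" "Suc l" p] by (simp add: H_def)
  qed
  have smHH: "smooth_map_from A H"
  proof (rule smooth_map_from_local[OF mfd])
    fix p assume p: "p \<in> topspace X"
    then obtain l where "\<rho> l p > 1" using cov by blast
    then have "p \<in> V l" using p by (simp add: V_def)
    then show "\<exists>W g. openin X W \<and> p \<in> W \<and> smooth_map_from A g \<and> (\<forall>q\<in>W. H q = g q)"
      using opV smH HV by blast
  qed
  have "independent_differentials d (F(s := H)) (insert s S) p" if d: "d \<in> A" and pd: "p \<in> fst d" for d p
  proof -
    have pX: "p \<in> topspace X" using chart_facts(2)[OF mfd, of "fst d" "snd d"] d pd by auto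
    then obtain l where l: "\<rho> l p > 1" using cov by blast
    \<comment> \<open>Here the inequality is not strict: minimality must give
      \<open>\<rho> i p < 1\<close> for all earlier \<open>i\<close>, since
      \<open>\<eta> i p\<close> already vanishes when \<open>\<rho> i p = 1\<close>, and
      \<open>T j p\<close> has to be nonzero.\<close>
    define j where "j = (LEAST j. \<rho> j p \<ge> 1)"
    have j: "\<rho> j p \<ge> 1" unfolding j_def by (rule LeastI[of _ l]) (use l in simp)
    have jl: "j \<le> l" unfolding j_def by (rule Least_le) (use l in simp)
    have small: "\<rho> i p < 1" if "i < j" for i using not_less_Least[OF that[unfolded j_def]] by simp
    obtain U \<phi> where cj: "c j = (U, \<phi>)" by fastforce
    have ch: "(U, \<phi>) \<in> A" "p \<in> U" using cA[of j] supp[of p j] j cj by auto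
    have "T j p \<noteq> 0" unfolding T_def using small by (fastforce simp: \<eta>_def exp_cutoff_def)
    then have "T j p * \<rho> j p \<noteq> 0" using j by simp
    then have avoid: "\<exists>v. differential (U, \<phi>) (Hs (Suc j)) p v \<noteq> (\<Sum>k\<in>S. a k * differential (U, \<phi>) (F k) p v)" for a
      using HR[of j] ch(2) unfolding R_def cj fst_conv by blast
    have d\<eta>: "differential (U, \<phi>) (\<eta> j) p = (\<lambda>v. 0)"
    proof (rule differential_eqI)
      have ip: "inv_into U \<phi> (\<phi> p) = p" by (rule inv_into_f_f[OF chart_facts(4)[OF mfd ch(1)] ch(2)])
      have "smooth_map_from A (\<lambda>q. 1 + - \<rho> j q)"
        by (intro smooth_map_from_add smooth_map_from_const
            smooth_map_from_bounded_linear[OF bounded_linear_minus[OF bounded_linear_ident]] sm\<rho>)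
      note D = differential_has_derivative[OF this ch]
      have "(exp_cutoff 0 has_derivative (\<lambda>v. 0)) (at (((\<lambda>q. 1 + - \<rho> j q) \<circ> inv_into U \<phi>) (\<phi> p)))"
        by (rule has_derivative_eq_rhs[OF exp_cutoff_DERIV[unfolded has_field_derivative_def]])
          (use j ip in \<open>simp add: exp_cutoff_def fun_eq_iff\<close>)
      from diff_chain_at[OF D this]
      show "((\<eta> j \<circ> inv_into U \<phi>) has_derivative (\<lambda>v. 0)) (at (\<phi> p))"
        by (simp add: comp_def \<eta>_def)
    qed
    \<comment> \<open>The product rule: at \<open>k = Suc j\<close> the factor
      \<open>\<eta> j\<close> vanishes at \<open>p\<close> together with its differential, and this
      passes to every further product.\<close>
    have dT: "differential (U, \<phi>) (T k) p = (\<lambda>v. 0)" if "Suc j \<le> k" for k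
      using that
    proof (induction k rule: dec_induct)
      case base
      have "\<eta> j p = 0" using j by (simp add: \<eta>_def exp_cutoff_def)
      then show ?case unfolding T_Suc differential_scaleR[OF smT sm\<eta> ch] d\<eta> by simp
    next
      case (step k)
      have "T k p = 0" by (rule T0[of j]) (use step j in auto)
      then show ?case unfolding T_Suc differential_scaleR[OF smT sm\<eta> ch] step.IH by simp
    qed
    \<comment> \<open>Both \<open>T k\<close> and its differential vanish at \<open>p\<close>, so
      each later increment \<open>T k q *\<^sub>R u k q\<close> has zero differential there,
      whatever \<open>u k\<close> is.\<close>
    have dH: "differential (U, \<phi>) (Hs k) p = differential (U, \<phi>) (Hs (Suc j)) p" if "Suc j \<le> k" for k
      using that
    proof (induction k rule: dec_induct)
      case (step k)
      have "T k p = 0" by (rule T0[of j]) (use step j in auto)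
      then show ?case
        unfolding Hs_Suc[of k] differential_add[OF smH smooth_map_from_scaleR[OF smT smu] ch]
          differential_scaleR[OF smT smu ch] dT[OF step.hyps(1)] step.IH by simp
    qed simp
    \<comment> \<open>The point \<open>p\<close> need not lie in \<open>V j\<close>, as
      \<open>\<rho> j p = 1\<close> is possible. So \<open>H\<close> is identified near
      \<open>p\<close> with the partial sum for \<open>l\<close>, and \<open>dH\<close> goes back
      from \<open>Suc l\<close> to \<open>Suc j\<close>.\<close>
    have "p \<in> V l" using l pX by (simp add: V_def)
    from differential_cong[OF ch opV this HV]
    have dHH: "differential (U, \<phi>) H p = differential (U, \<phi>) (Hs (Suc j)) p" using dH[of "Suc l"] jl by simp
    have "independent_differentials (U, \<phi>) (F(s := H)) (insert s S) p"
      by (rule independent_differentials_insert[OF _ s indep[OF ch(1)]])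
        (use ch(2) avoid dHH in auto)
    moreover have "smooth_map_from A ((F(s := H)) k)" if "k \<in> insert s S" for k
      using that F smHH by (cases "k = s") auto
    ultimately have "independent_differentials (fst d, snd d) (F(s := H)) (insert s S) p"
      using independent_differentials_change_chart[of "insert s S" "F(s := H)" U \<phi> p "fst d" "snd d"] ch d pd
      by simp
    then show ?thesis by simp
  qed
  with smHH show ?thesis by blast
qed

text \<open>Induction over the index set from the empty family; the bound on CARD('m) is the one
  required at each extension, whatever the size of \<open>S\<close>.\<close>

lemma exists_independent_differentials:
  assumes dim: "2 * CARD('m::finite) \<le> CARD('n) + 1" and ne: "topspace X \<noteq> {}"
  shows "\<exists>F :: 'm \<Rightarrow> 'a \<Rightarrow> complex. (\<forall>k. smooth_map_from A (F k)) \<and>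
    (\<forall>c\<in>A. \<forall>p\<in>fst c. independent_differentials c F UNIV p)"
proof -
  have "\<exists>F :: 'm \<Rightarrow> 'a \<Rightarrow> complex. (\<forall>k\<in>S. smooth_map_from A (F k)) \<and>
    (\<forall>c\<in>A. \<forall>p\<in>fst c. independent_differentials c F S p)" for S
    using finite[of S]
  proof (induction S rule: finite_induct)
    case empty show ?case by (simp add: independent_differentials_def)
  next
    case (insert s S)
    then obtain F :: "'m \<Rightarrow> 'a \<Rightarrow> complex" where F: "\<And>k. k \<in> S \<Longrightarrow> smooth_map_from A (F k)"
      "\<And>c p. c \<in> A \<Longrightarrow> p \<in> fst c \<Longrightarrow> independent_differentials c F S p" by blast
    obtain H where H: "smooth_map_from A H"
      "\<forall>c\<in>A. \<forall>p\<in>fst c. independent_differentials c (F(s := H)) (insert s S) p"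
      using extend_independent_differentials[OF F insert.hyps(2) dim ne] by blast
    have "smooth_map_from A ((F(s := H)) k)" if "k \<in> insert s S" for k
      using that F(1) H(1) by (cases "k = s") auto
    with H(2) show ?case by blast
  qed
  from this[of UNIV] show ?thesis by simp
qed

end

section \<open>Assembling the functions into a map to complex space\<close>

lemma bounded_linear_axis: "bounded_linear (axis k :: 'f::euclidean_space \<Rightarrow> 'f ^ 'm)"
  unfolding linear_conv_bounded_linear[symmetric]
  by (auto simp: linear_iff vec_eq_iff axis_def)

theorem theorem1p2:
  fixes X :: "'a topology" and A :: "('a, 'n::finite) chart set"
  assumes "smooth_manifold X A"
    and "CARD('m::finite) \<le> (CARD('n) + 1) div 2"
  shows "\<exists>F :: 'a \<Rightarrow> complex ^ 'm. smooth_map_from A F \<and>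
           (\<forall>p\<in>topspace X. independent_coordinates_at A F p)"
proof (cases "topspace X = {}")
  \<comment> \<open>The bump sequence requires a point of \<open>X\<close>; over the empty space
    independence is vacuous.\<close>
  case True
  then show ?thesis by (intro exI[of _ "\<lambda>_. 0"]) (simp add: smooth_map_from_const)
next
  case False
  have "2 * CARD('m) \<le> CARD('n) + 1" using assms(2) by linarith
  from exists_independent_differentials[OF assms(1) this False]
  obtain F :: "'m \<Rightarrow> 'a \<Rightarrow> complex" where F: "\<And>k. smooth_map_from A (F k)"
    "\<And>c p. c \<in> A \<Longrightarrow> p \<in> fst c \<Longrightarrow> independent_differentials c F UNIV p" by blast
  define G where "G = (\<lambda>p. \<Sum>k\<in>UNIV. axis k (F k p))"
  have "smooth_map_from A G"
    unfolding G_def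
    by (intro smooth_map_from_sum finite smooth_map_from_bounded_linear[OF bounded_linear_axis] F(1))
  moreover have G: "(\<lambda>x. G x $ i) = F i" for i
    by (simp add: G_def fun_eq_iff axis_def)
  have "independent_coordinates_at A G p" for p
    unfolding independent_coordinates_at_def G
  proof (intro ballI impI wedge_nonzero)
    fix c a assume c: "c \<in> A" "p \<in> fst c" and a: "\<And>v. (\<Sum>k\<in>UNIV. a k * differential c (F k) p v) = 0"
    from F(2)[OF c] a show "\<forall>k. a k = 0" unfolding independent_differentials_def by simp
  qed
  ultimately show ?thesis by blast
qed

end
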